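(* Let $v\in H^{-1}_{loc}(\mathbb{R})$ be $\pi$-periodic, $v=C+Q'$ with $C\in\mathbb{C}$ and $Q\in L^2_{loc}(\mathbb{R})$ $\pi$-periodic with $\int_0^\pi Q=0$. Let $L_{Dir}(v)$ be the operator in $H^0=L^2([0,\pi])$ given by $L_{Dir}(v)y=\ell_Q(y):=-(y'-Qy)'-Qy'+Cy$ on $$D(L_{Dir}(v))=\{y\in H^1([0,\pi]):\ y'-Qy\in W^1_1([0,\pi]),\ y(0)=y(\pi)=0,\ \ell_Q(y)\in H^0\}.$$ Then: (a) $D(L_{Dir}(v))$ is dense in $H^0$; (b) $L_{Dir}(v)$ is closed and $(L_{Dir}(v))^*=L_{Dir}(\overline{v})$ (in particular, if $v$ is real-valued, $L_{Dir}(v)$ is self-adjoint); (c) the spectrum of $L_{Dir}(v)$ is discrete, and $$Sp(L_{Dir}(v))=\{\lambda\in\mathbb{C}:\ y_2(\pi,\lambda)=0\}.$$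
   Context: $H^{-1}_{loc}(\mathbb{R})$: distributions $v$ such that for every $T>0$ there is $C(T)$ with $|\langle v,\varphi\rangle|\le C(T)(\int_{-T}^T|\varphi|^2+|\varphi'|^2)^{1/2}$ for smooth $\varphi$ supported in $[-T,T]$; $\pi$-periodicity means $\langle v,\varphi(x)\rangle=\langle v,\varphi(x-\pi)\rangle$. The representation $v=C+Q'$ exists and is unique; $\overline v=\overline C+\overline Q'$. $W^1_1([0,\pi])$: absolutely continuous functions. $H^0$ carries the inner product $\frac1\pi\int_0^\pi f\overline g$. For $\lambda\in\mathbb{C}$, $(y_2(x,\lambda),u_2(x,\lambda))$ is the solution of $y'=Qy+u$, $u'=(C-\lambda-Q^2)y-Qu$ with $y_2(0,\lambda)=0$, $u_2(0,\lambda)=1$. *)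

theory Defs
  imports "HOL-Analysis.Analysis"
begin

text \<open>H^0 = L^2([0,pi]) with complex-valued functions, elements handled as
  functions modulo a.e. equality on [0,pi].\<close>

definition L2 :: "(real \<Rightarrow> complex) \<Rightarrow> bool" where
  "L2 f \<longleftrightarrow> f \<in> borel_measurable (lebesgue_on {0..pi}) \<and>
     integrable (lebesgue_on {0..pi}) (\<lambda>x. (cmod (f x))^2)"

definition L1 :: "(real \<Rightarrow> complex) \<Rightarrow> bool" where
  "L1 f \<longleftrightarrow> integrable (lebesgue_on {0..pi}) f"

definition ae_eq :: "(real \<Rightarrow> complex) \<Rightarrow> (real \<Rightarrow> complex) \<Rightarrow> bool" where
  "ae_eq f g \<longleftrightarrow> (AE x in lebesgue_on {0..pi}. f x = g x)"

definition H0_inner :: "(real \<Rightarrow> complex) \<Rightarrow> (real \<Rightarrow> complex) \<Rightarrow> complex" where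
  "H0_inner f g = (LINT x|lebesgue_on {0..pi}. f x * cnj (g x)) / of_real pi"

definition H0_norm :: "(real \<Rightarrow> complex) \<Rightarrow> real" where
  "H0_norm f = sqrt ((LINT x|lebesgue_on {0..pi}. (cmod (f x))^2) / pi)"

text \<open>y is absolutely continuous on [0,pi] with (a.e.) derivative y'.\<close>
definition prim :: "(real \<Rightarrow> complex) \<Rightarrow> (real \<Rightarrow> complex) \<Rightarrow> bool" where
  "prim y y' \<longleftrightarrow> (\<forall>x\<in>{0..pi}. y x = y 0 + integral\<^sup>L (lebesgue_on {0..x}) y')"

text \<open>Graph of L_Dir(v), v = C + Q': LDir Q C y f means y \<in> D(L_Dir(v)) and
  L_Dir(v) y = f (as elements of H^0).  Here y' is the L^2 derivative of y,
  z is the W^1_1 representative of y' - Q y, and w = z'.\<close>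
definition LDir :: "(real \<Rightarrow> complex) \<Rightarrow> complex \<Rightarrow> (real \<Rightarrow> complex) \<Rightarrow> (real \<Rightarrow> complex) \<Rightarrow> bool" where
  "LDir Q C y f \<longleftrightarrow>
     (\<exists>y' z w. L2 y' \<and> prim y y' \<and> L1 w \<and> prim z w \<and>
        ae_eq z (\<lambda>x. y' x - Q x * y x) \<and> y 0 = 0 \<and> y pi = 0 \<and>
        L2 f \<and> ae_eq f (\<lambda>x. - w x - Q x * y' x + C * y x))"

definition dense_domain :: "(real \<Rightarrow> complex) \<Rightarrow> complex \<Rightarrow> bool" where
  "dense_domain Q C \<longleftrightarrow> (\<forall>g. L2 g \<longrightarrow> (\<forall>e>0. \<exists>y f. LDir Q C y f \<and> H0_norm (\<lambda>x. y x - g x) < e))"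

definition closed_op :: "(real \<Rightarrow> complex) \<Rightarrow> complex \<Rightarrow> bool" where
  "closed_op Q C \<longleftrightarrow> (\<forall>ys fs y f. (\<forall>n. LDir Q C (ys n) (fs n)) \<and> L2 y \<and> L2 f \<and>
      (\<lambda>n. H0_norm (\<lambda>x. ys n x - y x)) \<longlonglongrightarrow> 0 \<and>
      (\<lambda>n. H0_norm (\<lambda>x. fs n x - f x)) \<longlonglongrightarrow> 0 \<longrightarrow>
      (\<exists>y1. ae_eq y1 y \<and> LDir Q C y1 f))"

definition adj_graph :: "(real \<Rightarrow> complex) \<Rightarrow> complex \<Rightarrow> (real \<Rightarrow> complex) \<Rightarrow> (real \<Rightarrow> complex) \<Rightarrow> bool" where
  "adj_graph Q C g h \<longleftrightarrow> L2 g \<and> L2 h \<and>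
     (\<forall>y f. LDir Q C y f \<longrightarrow> H0_inner f g = H0_inner y h)"

definition resolvent_set :: "(real \<Rightarrow> complex) \<Rightarrow> complex \<Rightarrow> complex set" where
  "resolvent_set Q C = {lam.
     (\<forall>f. L2 f \<longrightarrow> (\<exists>y. LDir Q C y (\<lambda>x. f x + lam * y x))) \<and>
     (\<forall>y. LDir Q C y (\<lambda>x. lam * y x) \<longrightarrow> ae_eq y (\<lambda>x. 0)) \<and>
     (\<exists>M. \<forall>y f. L2 f \<and> LDir Q C y (\<lambda>x. f x + lam * y x) \<longrightarrow> H0_norm y \<le> M * H0_norm f)}"

definition spectrum_op :: "(real \<Rightarrow> complex) \<Rightarrow> complex \<Rightarrow> complex set" where
  "spectrum_op Q C = - resolvent_set Q C"

definition eigenvalue :: "(real \<Rightarrow> complex) \<Rightarrow> complex \<Rightarrow> complex \<Rightarrow> bool" where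
  "eigenvalue Q C lam \<longleftrightarrow> (\<exists>y. LDir Q C y (\<lambda>x. lam * y x) \<and> \<not> ae_eq y (\<lambda>x. 0))"

definition root_vector :: "(real \<Rightarrow> complex) \<Rightarrow> complex \<Rightarrow> complex \<Rightarrow> (real \<Rightarrow> complex) \<Rightarrow> bool" where
  "root_vector Q C lam y \<longleftrightarrow> (\<exists>k ys. ys 0 = y \<and>
     (\<forall>j<k. LDir Q C (ys j) (\<lambda>x. ys (Suc j) x + lam * ys j x)) \<and> ae_eq (ys k) (\<lambda>x. 0))"

definition finite_alg_mult :: "(real \<Rightarrow> complex) \<Rightarrow> complex \<Rightarrow> complex \<Rightarrow> bool" where
  "finite_alg_mult Q C lam \<longleftrightarrow> (\<exists>bs :: (real \<Rightarrow> complex) list.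
     \<forall>y. root_vector Q C lam y \<longrightarrow>
       (\<exists>c :: nat \<Rightarrow> complex. ae_eq y (\<lambda>x. \<Sum>i<length bs. c i * (bs ! i) x)))"

definition discrete_spectrum :: "(real \<Rightarrow> complex) \<Rightarrow> complex \<Rightarrow> bool" where
  "discrete_spectrum Q C \<longleftrightarrow> (\<forall>z. \<not> z islimpt spectrum_op Q C) \<and>
     (\<forall>lam \<in> spectrum_op Q C. eigenvalue Q C lam \<and> finite_alg_mult Q C lam)"

definition is_sol2 :: "(real \<Rightarrow> complex) \<Rightarrow> complex \<Rightarrow> complex \<Rightarrow> (real \<Rightarrow> complex) \<Rightarrow> (real \<Rightarrow> complex) \<Rightarrow> bool" where
  "is_sol2 Q C lam y u \<longleftrightarrow> continuous_on {0..pi} y \<and> continuous_on {0..pi} u \<and>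
     L1 (\<lambda>t. Q t * y t + u t) \<and> L1 (\<lambda>t. (C - lam - (Q t)^2) * y t - Q t * u t) \<and>
     (\<forall>x\<in>{0..pi}. y x = integral\<^sup>L (lebesgue_on {0..x}) (\<lambda>t. Q t * y t + u t) \<and>
        u x = 1 + integral\<^sup>L (lebesgue_on {0..x}) (\<lambda>t. (C - lam - (Q t)^2) * y t - Q t * u t))"

definition y2_pi :: "(real \<Rightarrow> complex) \<Rightarrow> complex \<Rightarrow> complex \<Rightarrow> complex" where
  "y2_pi Q C lam = (THE w. \<exists>y u. is_sol2 Q C lam y u \<and> y pi = w)"

end

theory Submission
  imports Defs "HOL-Complex_Analysis.Conformal_Mappings"
begin

text \<open>
  With \<open>u = y' - Qy\<close> the equation \<open>(L - \<lambda>) y = f\<close> becomes a first-order linear system with integrable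
  coefficients, i.e. a Volterra equation, which is solved by contraction in a weighted sup norm. If
  \<open>y2(\<pi>, \<lambda>) \<noteq> 0\<close>, the boundary value problem is uniquely solvable with a bound by the \<open>L\<^sup>1\<close> norm of
  \<open>f\<close>; otherwise \<open>y2\<close> is an eigenfunction. The function \<open>y2(\<pi>, \<lambda>)\<close> is entire, and coercivity shows that it
  is not identically zero, so its zeros are isolated. A Jordan chain at a zero expands in the Taylor coefficients of \<open>y2\<close>
  in \<open>\<lambda>\<close>, and the order of the zero bounds its length. Closedness and the adjoint follow from solvability at
  one regular \<open>\<lambda>\<close> and Lagrange's identity. For density, \<open>Q\<close> and the target are approximated
  by polynomials \<open>p\<close> and \<open>g\<close>, and \<open>(L(Q) - \<lambda>) y = (L(p) - \<lambda>) g\<close> is solved.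
\<close>

text \<open>For nonsmooth \<open>Q\<close> neither \<open>Q'\<close> nor \<open>y''\<close> need be
  a function. Rewriting everything in \<open>y\<close> and \<open>u\<close> leaves only
  \<open>Q\<close> and \<open>Q^2\<close> as coefficients, and \<open>Q^2\<close> is merely
  integrable: hence weights built from indefinite integrals instead of sup bounds on the
  coefficients. Solutions are only absolutely continuous, so product and chain rules are derived
  from increments measured by an indefinite integral rather than by length. The domain need not
  contain smooth functions: absolute continuity of \<open>g' - Qg\<close> for smooth
  \<open>g\<close> forces regularity of \<open>Q\<close> wherever \<open>g\<close> is nonzero. As
  the potential may be complex, no symmetry argument provides such a point; that is the role of
  coercivity. Multiplicities are controlled without compact operators: the Taylor coefficients in
  the spectral parameter are themselves solutions of the system, and their values at
  \<open>pi\<close> decide which of them meet the boundary condition.\<close>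

text \<open>\<open>D\<close> factors through \<open>\<mu>\<close>, and the factor has zero derivative on an interval.\<close>
lemma constant_of_quadratic_increments:
  fixes D :: "real \<Rightarrow> complex" and \<mu> :: "real \<Rightarrow> real"
  assumes mono: "\<And>x y. a \<le> x \<Longrightarrow> x \<le> y \<Longrightarrow> y \<le> b \<Longrightarrow> \<mu> x \<le> \<mu> y"
    and cont: "continuous_on {a..b} \<mu>"
    and incr: "\<And>x y. a \<le> x \<Longrightarrow> x \<le> y \<Longrightarrow> y \<le> b \<Longrightarrow> norm (D y - D x) \<le> K * (\<mu> y - \<mu> x)\<^sup>2"
    and x: "x \<in> {a..b}"
  shows "D x = D a"
proof -
  define S where "S = \<mu> ` {a..b}"
  define g where "g = inv_into {a..b} \<mu>"
  define h where "h = D \<circ> g"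
  have g: "g s \<in> {a..b}" "\<mu> (g s) = s" if "s \<in> S" for s
    using that unfolding S_def g_def by (auto intro: inv_into_into f_inv_into_f simp del: atLeastAtMost_iff)
  have incr': "norm (D y - D x) \<le> K * (\<mu> y - \<mu> x)\<^sup>2" if "x \<in> {a..b}" "y \<in> {a..b}" for x y
    using incr[of x y] incr[of y x] that
    by (cases "x \<le> y") (auto simp: norm_minus_commute power2_commute)
  have hq: "norm (h s - h t) \<le> K * (s - t)\<^sup>2" if "s \<in> S" "t \<in> S" for s t
    using incr'[of "g t" "g s"] g that unfolding h_def by auto
  have "connected S" unfolding S_def using cont by (intro connected_continuous_image) auto
  then have "convex S" by (metis is_interval_connected_1 is_interval_convex_1)
  moreover have "(h has_derivative (\<lambda>_. 0)) (at s within S)" if "s \<in> S" for s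
  proof (subst has_derivative_iff_norm, intro conjI)
    show "bounded_linear (\<lambda>_::real. 0::complex)" by simp
    have "((\<lambda>t. \<bar>K\<bar> * norm (t - s)) \<longlongrightarrow> \<bar>K\<bar> * norm (s - s)) (at s within S)"
      by (intro tendsto_intros)
    then have "((\<lambda>t. \<bar>K\<bar> * norm (t - s)) \<longlongrightarrow> 0) (at s within S)" by simp
    then show "((\<lambda>t. norm (h t - h s - 0) / norm (t - s)) \<longlongrightarrow> 0) (at s within S)"
    proof (rule Lim_null_comparison[rotated])
      show "\<forall>\<^sub>F t in at s within S. norm (norm (h t - h s - 0) / norm (t - s)) \<le> \<bar>K\<bar> * norm (t - s)"
        unfolding eventually_at_filter
      proof (rule always_eventually, intro allI impI)
        fix t assume t: "t \<noteq> s" "t \<in> S"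
        have "norm (h t - h s) \<le> K * (t - s)\<^sup>2" using hq t that by blast
        also have "\<dots> \<le> \<bar>K\<bar> * (t - s)\<^sup>2" by (intro mult_right_mono) auto
        also have "\<dots> = (\<bar>K\<bar> * norm (t - s)) * norm (t - s)"
          by (simp add: power2_eq_square)
        finally show "norm (norm (h t - h s - 0) / norm (t - s)) \<le> \<bar>K\<bar> * norm (t - s)"
          using t by (simp add: divide_le_eq)
      qed
    qed
  qed
  ultimately obtain c where c: "\<And>s. s \<in> S \<Longrightarrow> h s = c"
    using has_derivative_zero_constant by metis
  have "D y = c" if "y \<in> {a..b}" for y
  proof -
    have S: "\<mu> y \<in> S" using that unfolding S_def by blast
    \<comment> \<open>\<open>y\<close> and the chosen preimage of \<open>\<mu> y\<close> have equal
      \<open>\<mu>\<close>, so the increment bound makes \<open>D\<close> agree there: the choice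
      made by \<open>inv_into\<close> does not matter.\<close>
    have "norm (D y - D (g (\<mu> y))) \<le> 0"
      using incr'[of "g (\<mu> y)" y] g[OF S] that by auto
    then show ?thesis using c[OF S] unfolding h_def by simp
  qed
  then show ?thesis using x by (metis atLeastAtMost_iff order_refl order_trans)
qed

section \<open>Indefinite integrals\<close>

abbreviation I_pi :: "real measure" where "I_pi \<equiv> lebesgue_on {0..pi}"

lemma integrable_I_pi_subinterval:
  fixes f :: "real \<Rightarrow> 'a::euclidean_space"
  assumes "integrable I_pi f" "0 \<le> a" "b \<le> pi"
  shows "integrable (lebesgue_on {a..b}) f" "f integrable_on {a..b}"
    "(\<lambda>x. norm (f x)) integrable_on {a..b}"
    "integral\<^sup>L (lebesgue_on {a..b}) f = integral {a..b} f"
proof -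
  show 1: "integrable (lebesgue_on {a..b}) f"
    using assms by (intro integrable_subinterval[of 0 pi f a b]) auto
  then show "integral\<^sup>L (lebesgue_on {a..b}) f = integral {a..b} f"
    by (simp add: lebesgue_integral_eq_integral)
  show "f integrable_on {a..b}" "(\<lambda>x. norm (f x)) integrable_on {a..b}"
    using 1 integrable_on_lebesgue_on[OF 1] integrable_on_lebesgue_on[OF integrable_norm[OF 1]] by auto
qed

lemma integral_I_pi_split:
  fixes f :: "real \<Rightarrow> 'a::euclidean_space"
  assumes "integrable I_pi f" "0 \<le> a" "a \<le> b" "b \<le> pi"
  shows "integral {0..b} f = integral {0..a} f + integral {a..b} f"
  using Henstock_Kurzweil_Integration.integral_combine[of 0 a b f] integrable_I_pi_subinterval(2)[OF assms(1), of 0 b] assms by auto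

lemma continuous_on_integral_I_pi:
  fixes f :: "real \<Rightarrow> 'a::euclidean_space"
  assumes "integrable I_pi f"
  shows "continuous_on {0..pi} (\<lambda>x. integral {0..x} f)"
  using indefinite_integral_continuous_1[OF integrable_I_pi_subinterval(2)[OF assms, of 0 pi]] by auto

lemma measurable_continuous_I_pi:
  fixes f :: "real \<Rightarrow> 'a::euclidean_space"
  assumes "continuous_on {0..pi} f" 
  shows "f \<in> borel_measurable I_pi"
  using assms by (simp add: continuous_imp_measurable_on_sets_lebesgue)

lemma integrable_mult_bounded:
  fixes f g :: "real \<Rightarrow> complex"
  assumes "integrable I_pi f" "g \<in> borel_measurable I_pi" "\<And>x. x \<in> {0..pi} \<Longrightarrow> norm (g x) \<le> B"
  shows "integrable I_pi (\<lambda>x. g x * f x)"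
proof (rule Bochner_Integration.integrable_bound[of _ "\<lambda>x. B * norm (f x)"])
  show "integrable I_pi (\<lambda>x. B * norm (f x))" using assms by auto
  show "(\<lambda>x. g x * f x) \<in> borel_measurable I_pi" using assms by auto
  show "AE x in I_pi. norm (g x * f x) \<le> norm (B * norm (f x))"
  proof (rule AE_I2)
    fix x assume "x \<in> space I_pi"
    then have "norm (g x) \<le> B" using assms by simp
    then have "norm (g x) * norm (f x) \<le> B * norm (f x)" by (intro mult_right_mono) auto
    then show "norm (g x * f x) \<le> norm (B * norm (f x))" by (simp add: norm_mult)
  qed
qed

lemma integrable_continuous_mult:
  fixes f g :: "real \<Rightarrow> complex"
  assumes "integrable I_pi f" "continuous_on {0..pi} g"
  shows "integrable I_pi (\<lambda>x. g x * f x)"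
proof -
  have "bounded (g ` {0..pi})" using assms(2) by (intro compact_imp_bounded compact_continuous_image) auto
  then obtain B where B: "\<forall>x\<in>{0..pi}. norm (g x) \<le> B" unfolding bounded_iff by auto
  show ?thesis by (rule integrable_mult_bounded[OF assms(1) measurable_continuous_I_pi[OF assms(2)]]) (use B in blast)
qed

lemma integrable_continuous_I_pi:
  fixes g :: "real \<Rightarrow> 'a::euclidean_space"
  assumes "continuous_on {0..pi} g"
  shows "integrable I_pi g"
  using assms continuous_imp_integrable_real by blast

lemma norm_integral_le_integral:
  fixes f :: "real \<Rightarrow> 'a::euclidean_space"
  assumes "integrable I_pi f" "integrable I_pi k" "0 \<le> a" "a \<le> b" "b \<le> pi" "\<And>t. t \<in> {a..b} \<Longrightarrow> norm (f t) \<le> k t"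
  shows "norm (integral {a..b} f) \<le> integral {a..b} k"
  using assms by (intro integral_norm_bound_integral integrable_I_pi_subinterval(2)) auto

text \<open>With \<open>\<mu>\<close> the indefinite integral of \<open>norm f + norm g\<close>, the
  increments of \<open>F\<close> and \<open>G\<close> are both at most those of
  \<open>\<mu>\<close>. The defect of the product formula then has increments quadratic in those of
  \<open>\<mu>\<close>, so it is constant; no almost-everywhere differentiation is involved.\<close>

lemma integration_by_parts_AC:
  fixes f g F G :: "real \<Rightarrow> complex"
  assumes f: "integrable I_pi f" and g: "integrable I_pi g"
    and F: "\<And>x. x \<in> {0..pi} \<Longrightarrow> F x = F 0 + integral {0..x} f"
    and G: "\<And>x. x \<in> {0..pi} \<Longrightarrow> G x = G 0 + integral {0..x} g"
    and x: "x \<in> {0..pi}"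
  shows "F x * G x = F 0 * G 0 + integral {0..x} (\<lambda>t. F t * g t + G t * f t)"
proof -
  have "continuous_on {0..pi} (\<lambda>x. F 0 + integral {0..x} f)" "continuous_on {0..pi} (\<lambda>x. G 0 + integral {0..x} g)"
    using f g by (auto intro!: continuous_intros continuous_on_integral_I_pi)
  then have cF: "continuous_on {0..pi} F" and cG: "continuous_on {0..pi} G"
    using F G continuous_on_cong by (smt (verit, best))+
  have Fg: "integrable I_pi (\<lambda>t. F t * g t)" "integrable I_pi (\<lambda>t. G t * f t)"
    using cF cG f g integrable_continuous_mult by auto
  then have H: "integrable I_pi (\<lambda>t. F t * g t + G t * f t)" by auto
  define k where "k = (\<lambda>t. norm (f t) + norm (g t))"
  have k: "integrable I_pi k" using f g unfolding k_def by auto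
  define \<mu> where "\<mu> = (\<lambda>x. integral {0..x} k)"
  define D where "D = (\<lambda>x. F x * G x - integral {0..x} (\<lambda>t. F t * g t + G t * f t))"
  have \<mu>diff: "\<mu> y - \<mu> x = integral {x..y} k" if "0 \<le> x" "x \<le> y" "y \<le> pi" for x y
    using integral_I_pi_split[OF k that] unfolding \<mu>_def by simp
  have mono: "\<mu> x \<le> \<mu> y" if "0 \<le> x" "x \<le> y" "y \<le> pi" for x y
  proof -
    have "0 \<le> integral {x..y} k" unfolding k_def by (rule Henstock_Kurzweil_Integration.integral_nonneg)
      (use that k in \<open>auto simp: k_def intro!: integrable_I_pi_subinterval(2)[of "\<lambda>t. norm (f t) + norm (g t)"]\<close>)
    then show ?thesis using \<mu>diff[OF that] by simp
  qed
  have Fd: "F y - F x = integral {x..y} f" "G y - G x = integral {x..y} g" if "0 \<le> x" "x \<le> y" "y \<le> pi" for x y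
    using F[of x] F[of y] G[of x] G[of y] integral_I_pi_split[OF f that] integral_I_pi_split[OF g that] that by auto
  have Fn: "norm (F y - F x) \<le> \<mu> y - \<mu> x" "norm (G y - G x) \<le> \<mu> y - \<mu> x" if "0 \<le> x" "x \<le> y" "y \<le> pi" for x y
    unfolding Fd[OF that] \<mu>diff[OF that] using f g k that by (auto intro!: norm_integral_le_integral simp: k_def)
  have "D x = D 0"
  proof (rule constant_of_quadratic_increments[OF mono _ _ x, where D = D and K = 1])
    show "continuous_on {0..pi} \<mu>" unfolding \<mu>_def using k by (rule continuous_on_integral_I_pi)
    fix a b assume ab: "0 \<le> a" "a \<le> b" "b \<le> pi"
    \<comment> \<open>Freezing \<open>F\<close> at \<open>b\<close> and \<open>G\<close> at
      \<open>a\<close> splits the increment of \<open>F * G\<close> exactly, with no cross term;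
      what remains pairs \<open>f\<close> and \<open>g\<close> with differences bounded by
      \<open>\<mu> b - \<mu> a\<close>.\<close>
    have eq: "D b - D a = integral {a..b} (\<lambda>t. (F b - F t) * g t + (G a - G t) * f t)"
    proof -
      have "D b - D a = F b * (G b - G a) + G a * (F b - F a) - integral {a..b} (\<lambda>t. F t * g t + G t * f t)"
        unfolding D_def using integral_I_pi_split[OF H ab] by (simp add: algebra_simps)
      also have "\<dots> = integral {a..b} (\<lambda>t. F b * g t + G a * f t) - integral {a..b} (\<lambda>t. F t * g t + G t * f t)"
        unfolding Fd[OF ab] using f g ab
        by (subst Henstock_Kurzweil_Integration.integral_add) (auto intro!: integrable_I_pi_subinterval(2) integrable_mult_right)
      also have "\<dots> = integral {a..b} (\<lambda>t. (F b * g t + G a * f t) - (F t * g t + G t * f t))"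
        using f g ab H
        by (intro Henstock_Kurzweil_Integration.integral_diff[symmetric]) (auto intro!: integrable_I_pi_subinterval(2) integrable_mult_right)
      also have "\<dots> = integral {a..b} (\<lambda>t. (F b - F t) * g t + (G a - G t) * f t)"
        by (intro arg_cong[where f="integral _"] ext) (simp add: algebra_simps)
      finally show ?thesis .
    qed
    have "norm (D b - D a) \<le> integral {a..b} (\<lambda>t. (\<mu> b - \<mu> a) * k t)"
      unfolding eq
    proof (rule norm_integral_le_integral)
      show "integrable I_pi (\<lambda>t. (F b - F t) * g t + (G a - G t) * f t)"
        using f g cF cG by (auto intro!: Bochner_Integration.integrable_add integrable_continuous_mult continuous_intros)
      show "integrable I_pi (\<lambda>t. (\<mu> b - \<mu> a) * k t)" using k by auto
      fix t assume t: "t \<in> {a..b}"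
      have "norm (F b - F t) \<le> \<mu> b - \<mu> a" "norm (G a - G t) \<le> \<mu> b - \<mu> a"
        using Fn[of t b] Fn[of a t] mono[of a t] mono[of t b] t ab by (auto simp: norm_minus_commute)
      then have "norm ((F b - F t) * g t) + norm ((G a - G t) * f t) \<le> (\<mu> b - \<mu> a) * norm (g t) + (\<mu> b - \<mu> a) * norm (f t)"
        unfolding norm_mult by (intro add_mono mult_right_mono) auto
      then show "norm ((F b - F t) * g t + (G a - G t) * f t) \<le> (\<mu> b - \<mu> a) * k t"
        unfolding k_def by (intro order_trans[OF norm_triangle_ineq]) (simp add: algebra_simps)
    qed (use ab in auto)
    also have "\<dots> = 1 * (\<mu> b - \<mu> a)\<^sup>2" by (simp add: \<mu>diff[OF ab] power2_eq_square)
    finally show "norm (D b - D a) \<le> 1 * (\<mu> b - \<mu> a)\<^sup>2" .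
  qed
  then show ?thesis unfolding D_def by (simp add: algebra_simps)
qed

text \<open>Chain rule for \<open>exp\<close> of an indefinite integral. On \<open>[a,b]\<close> the
  integral and the increment of the exponential both lie between \<open>d * E a\<close> and
  \<open>d * E b\<close>, where \<open>d\<close> is the increment of the exponent, so they differ by
  at most \<open>d * (E b - E a)\<close>, which is quadratic in \<open>d\<close>.\<close>

lemma integral_mult_exp_AC:
  fixes m :: "real \<Rightarrow> real"
  assumes m: "integrable I_pi m" and pos: "\<And>t. 0 \<le> m t" and x: "x \<in> {0..pi}"
  shows "integral {0..x} (\<lambda>t. m t * exp (integral {0..t} m)) = exp (integral {0..x} m) - 1"
proof -
  define \<mu> where "\<mu> = (\<lambda>x. integral {0..x} m)"
  define E where "E = (\<lambda>x. exp (\<mu> x))"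
  have c\<mu>: "continuous_on {0..pi} \<mu>" unfolding \<mu>_def using m by (rule continuous_on_integral_I_pi)
  then have cE: "continuous_on {0..pi} E" unfolding E_def by (intro continuous_intros)
  have \<mu>diff: "\<mu> y - \<mu> x = integral {x..y} m" if "0 \<le> x" "x \<le> y" "y \<le> pi" for x y
    using integral_I_pi_split[OF m that] unfolding \<mu>_def by simp
  have mono: "\<mu> x \<le> \<mu> y" if "0 \<le> x" "x \<le> y" "y \<le> pi" for x y
  proof -
    have "0 \<le> integral {x..y} m" by (rule Henstock_Kurzweil_Integration.integral_nonneg)
      (use that m pos in \<open>auto intro!: integrable_I_pi_subinterval(2)\<close>)
    then show ?thesis using \<mu>diff[OF that] by simp
  qed
  \<comment> \<open>The multiplier lemma and the constancy lemma speak of complex values, hence the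
    embeddings here and below.\<close>
  have "integrable I_pi (\<lambda>t. complex_of_real (E t) * complex_of_real (m t))"
    using m cE by (intro integrable_continuous_mult) (auto intro!: continuous_intros)
  then have "integrable I_pi (\<lambda>t. Re (complex_of_real (E t) * complex_of_real (m t)))" by (intro integrable_Re)
  then have H: "integrable I_pi (\<lambda>t. m t * E t)" by (simp add: mult.commute)
  define D where "D = (\<lambda>x. E x - integral {0..x} (\<lambda>t. m t * E t))"
  have "complex_of_real (D x) = complex_of_real (D 0)"
  proof (rule constant_of_quadratic_increments[OF mono c\<mu> _ x, of "\<lambda>x. complex_of_real (D x)" "exp (\<mu> pi)"])
    fix a b assume ab: "0 \<le> a" "a \<le> b" "b \<le> pi"
    define d where "d = \<mu> b - \<mu> a"
    have d: "0 \<le> d" "d = integral {a..b} m" using mono[OF ab] \<mu>diff[OF ab] unfolding d_def by auto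
    have eq: "D b - D a = E b - E a - integral {a..b} (\<lambda>t. m t * E t)"
      unfolding D_def using integral_I_pi_split[OF H ab] by simp
    have int: "m integrable_on {a..b}" "(\<lambda>t. m t * E t) integrable_on {a..b}"
      using m H ab by (auto intro!: integrable_I_pi_subinterval(2))
    have "integral {a..b} (\<lambda>t. m t * E t) \<le> integral {a..b} (\<lambda>t. m t * E b)"
      using int ab pos mono unfolding E_def by (intro integral_le) (auto intro!: mult_left_mono)
    then have i1: "integral {a..b} (\<lambda>t. m t * E t) \<le> d * E b" using d by simp
    have "integral {a..b} (\<lambda>t. m t * E a) \<le> integral {a..b} (\<lambda>t. m t * E t)"
      using int ab pos mono unfolding E_def by (intro integral_le) (auto intro!: mult_left_mono)
    then have i2: "d * E a \<le> integral {a..b} (\<lambda>t. m t * E t)" using d by simp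
    have Eb: "E b = E a * exp d" "E a = E b * exp (- d)" unfolding E_def d_def by (auto simp flip: exp_add)
    have Epos: "E a > 0" "E b > 0" unfolding E_def by auto
    have i3: "d * E a \<le> E b - E a"
      using mult_left_mono[OF exp_ge_add_one_self[of d], of "E a"] Eb(1) Epos by (simp add: algebra_simps)
    have i4: "E b - E a \<le> d * E b"
      using mult_left_mono[OF exp_ge_add_one_self[of "- d"], of "E b"] Eb(2) Epos by (simp add: algebra_simps)
    have "\<bar>D b - D a\<bar> \<le> d * (E b - E a)" unfolding eq using i1 i2 i3 i4 by (simp add: abs_le_iff algebra_simps)
    also have "\<dots> \<le> d * (d * E b)" using i4 d by (intro mult_left_mono) auto
    also have "\<dots> \<le> d * (d * exp (\<mu> pi))" unfolding E_def using d mono[of b pi] ab by (intro mult_left_mono) auto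
    finally show "norm (complex_of_real (D b) - complex_of_real (D a)) \<le> exp (\<mu> pi) * (\<mu> b - \<mu> a)\<^sup>2"
      unfolding of_real_diff[symmetric] norm_of_real d_def[symmetric] by (simp add: power2_eq_square mult_ac)
  qed
  then have "D x = D 0" by (simp only: of_real_eq_iff)
  then show ?thesis unfolding D_def E_def \<mu>_def by (simp add: algebra_simps)
qed

section \<open>Volterra equations\<close>

text \<open>Why the weight carries a 2: against \<open>m\<close> it integrates to less than half of
  its own value, which becomes the contraction factor 1/2 and the absorbed half of the a priori
  bound below. It is the previous lemma for \<open>2 * m\<close>.\<close>

lemma integral_weighted_exp:
  fixes m :: "real \<Rightarrow> real"
  assumes m: "integrable I_pi m" and pos: "\<And>t. 0 \<le> m t" and x: "x \<in> {0..pi}"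
  shows "integrable I_pi (\<lambda>t. m t * exp (2 * integral {0..t} m))"
    and "integral {0..x} (\<lambda>t. m t * exp (2 * integral {0..t} m)) = (exp (2 * integral {0..x} m) - 1) / 2"
proof -
  have "continuous_on {0..pi} (\<lambda>t. exp (2 * integral {0..t} m))"
    using m by (intro continuous_intros continuous_on_integral_I_pi)
  then have "integrable I_pi (\<lambda>t. complex_of_real (exp (2 * integral {0..t} m)) * complex_of_real (m t))"
    using m by (intro integrable_continuous_mult continuous_on_of_real) auto
  then have "integrable I_pi (\<lambda>t. Re (complex_of_real (exp (2 * integral {0..t} m)) * complex_of_real (m t)))" by (intro integrable_Re)
  then show int: "integrable I_pi (\<lambda>t. m t * exp (2 * integral {0..t} m))" by (simp add: mult.commute)
  have "integral {0..x} (\<lambda>t. 2 * m t * exp (integral {0..t} (\<lambda>t. 2 * m t))) = exp (integral {0..x} (\<lambda>t. 2 * m t)) - 1"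
    using m pos x by (intro integral_mult_exp_AC) auto
  then show "integral {0..x} (\<lambda>t. m t * exp (2 * integral {0..t} m)) = (exp (2 * integral {0..x} m) - 1) / 2"
    by (simp add: mult.assoc)
qed

text \<open>Gronwall by absorption: at a maximum point \<open>x0\<close> of
  \<open>norm Y / E\<close> the integral term is at most \<open>Z * (E x0 - 1) / 2\<close>, hence at
  most half of \<open>norm (Y x0) = Z * E x0\<close>, and moves to the left. \<open>b\<close> stands
  for the integrand formed from \<open>Y\<close>; only its size matters.\<close>

lemma volterra_bound:
  fixes Y g b :: "real \<Rightarrow> 'a::euclidean_space" and m :: "real \<Rightarrow> real"
  assumes m: "integrable I_pi m" and pos: "\<And>t. 0 \<le> m t"
    and Y: "continuous_on {0..pi} Y" and b: "integrable I_pi b"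
    and bm: "\<And>t. t \<in> {0..pi} \<Longrightarrow> norm (b t) \<le> m t * norm (Y t)"
    and eq: "\<And>x. x \<in> {0..pi} \<Longrightarrow> Y x = g x + integral {0..x} b"
    and G: "\<And>x. x \<in> {0..pi} \<Longrightarrow> norm (g x) \<le> G"
    and x: "x \<in> {0..pi}"
  shows "norm (Y x) \<le> 2 * G * exp (2 * integral {0..pi} m)"
proof -
  define E where "E = (\<lambda>x. exp (2 * integral {0..x} m))"
  have cE: "continuous_on {0..pi} E"
    unfolding E_def using m by (intro continuous_intros continuous_on_integral_I_pi)
  have Epos: "E x > 0" for x unfolding E_def by simp
  have mono: "integral {0..x} m \<le> integral {0..y} m" "0 \<le> integral {0..x} m" if "0 \<le> x" "x \<le> y" "y \<le> pi" for x y
    using that m pos by (auto intro!: integral_subset_le integrable_I_pi_subinterval(2) Henstock_Kurzweil_Integration.integral_nonneg)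
  have "\<exists>x\<in>{0..pi}. \<forall>y\<in>{0..pi}. norm (Y y) / E y \<le> norm (Y x) / E x"
    using Y cE Epos by (intro continuous_attains_sup continuous_intros) (auto simp: less_imp_neq[symmetric])
  then obtain x0 where x0: "x0 \<in> {0..pi}" and "\<forall>y\<in>{0..pi}. norm (Y y) / E y \<le> norm (Y x0) / E x0" by blast
  define Z where "Z = norm (Y x0) / E x0"
  have Z': "\<forall>y\<in>{0..pi}. norm (Y y) / E y \<le> Z" unfolding Z_def by fact
  have Z: "norm (Y y) \<le> Z * E y" if "y \<in> {0..pi}" for y
    using that Z' pos_divide_le_eq[OF Epos[of y]] by blast
  have Z0: "Z \<ge> 0" unfolding Z_def using Epos[of x0] by simp
  have "norm (integral {0..x0} b) \<le> integral {0..x0} (\<lambda>t. Z * (m t * E t))"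
  proof (rule norm_integral_le_integral[OF b])
    show "integrable I_pi (\<lambda>t. Z * (m t * E t))" unfolding E_def using integral_weighted_exp(1)[OF m pos x] by auto
    fix t assume "t \<in> {0..x0}"
    then have t: "t \<in> {0..pi}" using x0 by auto
    show "norm (b t) \<le> Z * (m t * E t)"
      using order_trans[OF bm[OF t] mult_left_mono[OF Z[OF t] pos[of t]]] by (simp add: mult_ac)
  qed (use x0 in auto)
  also have "\<dots> = Z * ((E x0 - 1) / 2)"
    using integral_weighted_exp(2)[OF m pos x0] unfolding E_def by simp
  finally have "norm (Y x0) \<le> G + Z * ((E x0 - 1) / 2)"
    unfolding eq[OF x0] using G[OF x0] by (intro order_trans[OF norm_triangle_ineq] add_mono)
  moreover have "norm (Y x0) = Z * E x0" unfolding Z_def using Epos[of x0] by simp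
  ultimately have "Z * E x0 + Z \<le> 2 * G" by argo
  moreover have "Z * 1 \<le> Z * E x0"
    unfolding E_def using mono(2)[of x0 x0] x0 Z0 by (intro mult_left_mono) auto
  ultimately have ZG: "Z \<le> 2 * G" using Z0 by simp
  have "norm (Y x) \<le> Z * E x" using Z[OF x] .
  also have "\<dots> \<le> (2 * G) * E pi"
    using ZG Z0 Epos[of x] mono(1)[of x pi] x by (intro mult_mono) (auto simp: E_def)
  finally show ?thesis unfolding E_def .
qed

text \<open>Banach's theorem is applied to \<open>Z = Y / E\<close>, for which the weighted sup norm
  is the ordinary one. With the weight a single application contracts on the whole interval, however
  large the integral of \<open>m\<close> is.\<close>

lemma volterra_solution_exists:
  fixes g :: "real \<Rightarrow> 'a::euclidean_space" and B :: "real \<Rightarrow> 'a \<Rightarrow> 'a" and m :: "real \<Rightarrow> real"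
  assumes m: "integrable I_pi m" and pos: "\<And>t. 0 \<le> m t"
    and int: "\<And>Y. continuous_on {0..pi} Y \<Longrightarrow> integrable I_pi (\<lambda>t. B t (Y t))"
    and lip: "\<And>t x y. norm (B t x - B t y) \<le> m t * norm (x - y)"
    and g: "continuous_on {0..pi} g"
  shows "\<exists>Y. continuous_on {0..pi} Y \<and> (\<forall>x\<in>{0..pi}. Y x = g x + integral {0..x} (\<lambda>t. B t (Y t)))"
proof -
  define E where "E = (\<lambda>x. exp (2 * integral {0..x} m))"
  have cE: "continuous_on {0..pi} E"
    unfolding E_def using m by (intro continuous_intros continuous_on_integral_I_pi)
  have Epos: "E x > 0" for x unfolding E_def by simp
  \<comment> \<open>Clamping to \<open>[0,pi]\<close> turns functions on the interval into bounded
    continuous functions on the line, so that the fixed point is sought in a complete metric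
    type.\<close>
  define c where "c = (\<lambda>x::real. max 0 (min pi x))"
  have c: "c x \<in> {0..pi}" for x unfolding c_def by auto
  have cc: "continuous_on UNIV c" unfolding c_def by (intro continuous_intros)
  define S where "S = (\<lambda>(Z::real \<Rightarrow> 'a) x. (1 / E x) *\<^sub>R (g x + integral {0..x} (\<lambda>t. B t (E t *\<^sub>R Z t))))"
  have intS: "integrable I_pi (\<lambda>t. B t (E t *\<^sub>R Z t))" if "continuous_on {0..pi} Z" for Z
    using that cE by (intro int continuous_intros)
  have cS: "continuous_on {0..pi} (S Z)" if "continuous_on {0..pi} Z" for Z
    unfolding S_def using that cE g Epos
    by (intro continuous_intros continuous_on_integral_I_pi intS) (auto simp: less_imp_neq[symmetric])
  define T where "T = (\<lambda>Z::real \<Rightarrow>\<^sub>C 'a. Bcontfun (\<lambda>x. S (apply_bcontfun Z) (c x)))"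
  have T: "apply_bcontfun (T Z) x = S (apply_bcontfun Z) (c x)" for Z x
  proof -
    have cS': "continuous_on {0..pi} (S (apply_bcontfun Z))" by (rule cS) auto
    have "continuous_on UNIV (\<lambda>x. S (apply_bcontfun Z) (c x))"
      by (rule continuous_on_compose2[OF cS' cc]) (use c in auto)
    moreover have "bounded (range (\<lambda>x. S (apply_bcontfun Z) (c x)))"
    proof (rule bounded_subset)
      show "bounded (S (apply_bcontfun Z) ` {0..pi})" using cS' by (intro compact_imp_bounded compact_continuous_image) auto
    qed (use c in auto)
    ultimately show ?thesis unfolding T_def by (subst Bcontfun_inverse) (auto simp: bcontfun_def)
  qed
  have contr: "dist (T Z) (T W) \<le> (1/2) * dist Z W" for Z W
  proof (rule dist_bound)
    fix x0 :: real
    define x where "x = c x0"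
    have x: "x \<in> {0..pi}" unfolding x_def by (rule c)
    define d where "d = dist Z W"
    have Zi: "integrable I_pi (\<lambda>t. B t (E t *\<^sub>R apply_bcontfun Z t))" "integrable I_pi (\<lambda>t. B t (E t *\<^sub>R apply_bcontfun W t))"
      by (auto intro!: intS)
    have "S Z x - S W x = (1 / E x) *\<^sub>R integral {0..x} (\<lambda>t. B t (E t *\<^sub>R Z t) - B t (E t *\<^sub>R W t))"
      unfolding S_def using Zi x
      by (subst Henstock_Kurzweil_Integration.integral_diff)
        (auto intro!: integrable_I_pi_subinterval(2) simp: algebra_simps)
    moreover have "norm (integral {0..x} (\<lambda>t. B t (E t *\<^sub>R Z t) - B t (E t *\<^sub>R W t))) \<le> integral {0..x} (\<lambda>t. d * (m t * E t))"
    proof (rule norm_integral_le_integral)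
      show "integrable I_pi (\<lambda>t. d * (m t * E t))" unfolding E_def using integral_weighted_exp(1)[OF m pos x] by auto
      fix t
      have "norm (B t (E t *\<^sub>R Z t) - B t (E t *\<^sub>R W t)) \<le> m t * norm (E t *\<^sub>R Z t - E t *\<^sub>R W t)" by (rule lip)
      also have "norm (E t *\<^sub>R Z t - E t *\<^sub>R W t) = E t * dist (Z t) (W t)"
        unfolding scaleR_diff_right[symmetric] norm_scaleR dist_norm using Epos[of t] by simp
      also have "m t * (E t * dist (Z t) (W t)) \<le> m t * (E t * d)"
        unfolding d_def using Epos[of t] pos[of t] dist_bounded[of Z t W] by (intro mult_left_mono) auto
      finally show "norm (B t (E t *\<^sub>R Z t) - B t (E t *\<^sub>R W t)) \<le> d * (m t * E t)" by (simp add: mult_ac)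
    qed (use x Zi in auto)
    moreover have "integral {0..x} (\<lambda>t. d * (m t * E t)) = d * ((E x - 1) / 2)"
      using integral_weighted_exp(2)[OF m pos x] unfolding E_def by simp
    ultimately have "norm (S Z x - S W x) \<le> (1 / E x) * (d * ((E x - 1) / 2))"
      using Epos[of x] by (simp only: norm_scaleR) (intro mult_mono, auto)
    also have "\<dots> = d / 2 - d / (2 * E x)" using Epos[of x] by (simp add: field_simps)
    also have "\<dots> \<le> d / 2" using Epos[of x] by (simp add: d_def)
    finally show "dist (T Z x0) (T W x0) \<le> (1/2) * dist Z W"
      unfolding T x_def[symmetric] dist_norm d_def by simp
  qed
  obtain Z where Z: "T Z = Z"
    using banach_fix_type[of "1/2" T] contr by auto
  have Zc: "continuous_on {0..pi} Z" by auto
  have "E x *\<^sub>R Z x = g x + integral {0..x} (\<lambda>t. B t (E t *\<^sub>R Z t))" if "x \<in> {0..pi}" for x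
  proof -
    have "Z x = S Z x" using T[of Z x] Z that by (simp add: c_def)
    then show ?thesis unfolding S_def using Epos[of x] by simp
  qed
  then show ?thesis
    using Zc cE by (intro exI[of _ "\<lambda>x. E x *\<^sub>R Z x"]) (auto intro!: continuous_intros)
qed

section \<open>Square integrable functions\<close>

text \<open>Completeness of Lebesgue measure, reached through extension by zero to the whole
  line.\<close>

lemma measurable_I_pi_cong_AE:
  fixes f g :: "real \<Rightarrow> complex"
  assumes "f \<in> borel_measurable I_pi" "AE x in I_pi. g x = f x"
  shows "g \<in> borel_measurable I_pi"
proof -
  have "(\<lambda>x. if x \<in> {0..pi} then f x else 0) \<in> borel_measurable lebesgue"
    using assms(1) by (subst borel_measurable_if) auto
  moreover have "AE x in lebesgue. (if x \<in> {0..pi} then f x else 0) = (if x \<in> {0..pi} then g x else 0)"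
    using assms(2) by (subst (asm) AE_restrict_space_iff) (auto elim: eventually_mono)
  ultimately have "(\<lambda>x. if x \<in> {0..pi} then g x else 0) \<in> borel_measurable lebesgue"
    by (rule borel_measurable_AE)
  then show ?thesis by (subst (asm) borel_measurable_if) auto
qed

lemma LINT_const_I_pi: "(LINT x|I_pi. (c::real)) = pi * c"
proof -
  have "(LINT x|I_pi. c) = integral {0..pi} (\<lambda>_. c)"
    by (intro integrable_I_pi_subinterval(4) integrable_continuous_I_pi) auto
  then show ?thesis by simp
qed

lemma L2_cong_AE:
  assumes f: "L2 f" and eq: "ae_eq g f"
  shows "L2 g"
proof -
  have fm: "f \<in> borel_measurable I_pi" and fi: "integrable I_pi (\<lambda>x. (cmod (f x))\<^sup>2)"
    using f unfolding L2_def by blast+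
  have g: "g \<in> borel_measurable I_pi"
    using fm eq[unfolded ae_eq_def] by (rule measurable_I_pi_cong_AE)
  have "AE x in I_pi. (cmod (f x))\<^sup>2 = (cmod (g x))\<^sup>2"
    using eq[unfolded ae_eq_def] by (rule eventually_mono) simp
  then have "integrable I_pi (\<lambda>x. (cmod (g x))\<^sup>2)"
    by (rule integrable_cong_AE_imp[OF fi, rotated]) (use g in measurable)
  then show ?thesis using g unfolding L2_def by blast
qed

lemma L2_continuous: "continuous_on {0..pi} f \<Longrightarrow> L2 f"
  unfolding L2_def
  by (intro conjI measurable_continuous_I_pi integrable_continuous_I_pi continuous_on_power continuous_on_norm)

lemma L2_mult_integrable:
  assumes "L2 f" "L2 g"
  shows "integrable I_pi (\<lambda>x. f x * g x)"
proof (rule Bochner_Integration.integrable_bound[of _ "\<lambda>x. (cmod (f x))\<^sup>2 + (cmod (g x))\<^sup>2"])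
  show "integrable I_pi (\<lambda>x. (cmod (f x))\<^sup>2 + (cmod (g x))\<^sup>2)" "(\<lambda>x. f x * g x) \<in> borel_measurable I_pi"
    using assms unfolding L2_def by auto
  show "AE x in I_pi. norm (f x * g x) \<le> norm ((cmod (f x))\<^sup>2 + (cmod (g x))\<^sup>2)"
  proof (rule AE_I2)
    fix x
    have "cmod (f x) * cmod (g x) \<le> (cmod (f x))\<^sup>2 + (cmod (g x))\<^sup>2"
      using sum_squares_bound[of "cmod (f x)" "cmod (g x)"] mult_nonneg_nonneg[of "cmod (f x)" "cmod (g x)"]
      unfolding mult.assoc by (smt (verit) norm_ge_zero)
    then show "norm (f x * g x) \<le> norm ((cmod (f x))\<^sup>2 + (cmod (g x))\<^sup>2)" by (simp add: norm_mult)
  qed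
qed

lemma L2_integrable: "L2 f \<Longrightarrow> integrable I_pi f"
  using L2_mult_integrable[of f "\<lambda>_. 1"] L2_continuous[of "\<lambda>_. 1"] by simp

lemma L2_mult_bounded:
  assumes "L2 f" "g \<in> borel_measurable I_pi" "\<And>x. x \<in> {0..pi} \<Longrightarrow> cmod (g x) \<le> B"
  shows "L2 (\<lambda>x. g x * f x)"
proof -
  have f: "f \<in> borel_measurable I_pi" "integrable I_pi (\<lambda>x. (cmod (f x))\<^sup>2)" using assms unfolding L2_def by auto
  have "integrable I_pi (\<lambda>x. (cmod (g x * f x))\<^sup>2)"
  proof (rule Bochner_Integration.integrable_bound)
    show "integrable I_pi (\<lambda>x. B\<^sup>2 * (cmod (f x))\<^sup>2)" using f by auto
    show "(\<lambda>x. (cmod (g x * f x))\<^sup>2) \<in> borel_measurable I_pi" using f assms by auto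
    show "AE x in I_pi. norm ((cmod (g x * f x))\<^sup>2) \<le> norm (B\<^sup>2 * (cmod (f x))\<^sup>2)"
      using assms(3) by (intro AE_I2) (auto simp: norm_mult power_mult_distrib intro!: mult_right_mono power_mono)
  qed
  then show ?thesis using f assms unfolding L2_def by auto
qed

lemma L2_add: "L2 f \<Longrightarrow> L2 g \<Longrightarrow> L2 (\<lambda>x. f x + g x)"
proof -
  assume f: "L2 f" and g: "L2 g"
  have "integrable I_pi (\<lambda>x. (cmod (f x + g x))\<^sup>2)"
  proof (rule Bochner_Integration.integrable_bound)
    show "integrable I_pi (\<lambda>x. 2 * (cmod (f x))\<^sup>2 + 2 * (cmod (g x))\<^sup>2)"
      using f g unfolding L2_def by auto
    show "(\<lambda>x. (cmod (f x + g x))\<^sup>2) \<in> borel_measurable I_pi" using f g unfolding L2_def by auto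
    show "AE x in I_pi. norm ((cmod (f x + g x))\<^sup>2) \<le> norm (2 * (cmod (f x))\<^sup>2 + 2 * (cmod (g x))\<^sup>2)"
    proof (rule AE_I2)
      fix x
      have "(cmod (f x + g x))\<^sup>2 \<le> (cmod (f x) + cmod (g x))\<^sup>2" by (intro power_mono norm_triangle_ineq) auto
      also have "\<dots> \<le> 2 * (cmod (f x))\<^sup>2 + 2 * (cmod (g x))\<^sup>2"
        using sum_squares_bound[of "cmod (f x)" "cmod (g x)"] by (simp add: power2_sum)
      finally show "norm ((cmod (f x + g x))\<^sup>2) \<le> norm (2 * (cmod (f x))\<^sup>2 + 2 * (cmod (g x))\<^sup>2)" by simp
    qed
  qed
  then show ?thesis using f g unfolding L2_def by auto
qed

lemma L2_cmult: "L2 f \<Longrightarrow> L2 (\<lambda>x. c * f x)"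
  using L2_mult_bounded[of f "\<lambda>_. c" "cmod c"] by auto

lemma L2_diff: "L2 f \<Longrightarrow> L2 g \<Longrightarrow> L2 (\<lambda>x. f x - g x)"
  using L2_add[of f "\<lambda>x. (-1) * g x"] L2_cmult[of g "-1"] by simp

lemma L2_cnj: "L2 f \<Longrightarrow> L2 (\<lambda>x. cnj (f x))"
  using measurable_compose[of f I_pi borel cnj borel] borel_measurable_continuous_onI[OF continuous_on_cnj[OF continuous_on_id]]
  unfolding L2_def by simp

lemma L2_continuous_mult:
  assumes "L2 f" "continuous_on {0..pi} g"
  shows "L2 (\<lambda>x. g x * f x)"
proof -
  have "bounded (g ` {0..pi})" using assms(2) by (intro compact_imp_bounded compact_continuous_image) auto
  then obtain B where B: "\<forall>x\<in>{0..pi}. norm (g x) \<le> B" unfolding bounded_iff by auto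
  show ?thesis by (rule L2_mult_bounded[OF assms(1) measurable_continuous_I_pi[OF assms(2)]]) (use B in blast)
qed

text \<open>The integral of the square of \<open>s * cmod f - t * cmod g\<close> is nonnegative for
  all real \<open>s\<close>, \<open>t\<close>; taking \<open>s = c\<close>, \<open>t = b\<close>
  gives the inequality unless \<open>c = 0\<close>.\<close>

lemma L2_Cauchy_Schwarz:
  assumes "L2 f" "L2 g"
  shows "(LINT x|I_pi. cmod (f x * g x)) \<le> sqrt (LINT x|I_pi. (cmod (f x))\<^sup>2) * sqrt (LINT x|I_pi. (cmod (g x))\<^sup>2)"
proof -
  define a b c where "a = (LINT x|I_pi. (cmod (f x))\<^sup>2)" "b = (LINT x|I_pi. cmod (f x * g x))" "c = (LINT x|I_pi. (cmod (g x))\<^sup>2)"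
  have int: "integrable I_pi (\<lambda>x. (cmod (f x))\<^sup>2)" "integrable I_pi (\<lambda>x. cmod (f x * g x))" "integrable I_pi (\<lambda>x. (cmod (g x))\<^sup>2)"
    using assms L2_mult_integrable[OF assms] unfolding L2_def by auto
  have nn: "a \<ge> 0" "b \<ge> 0" "c \<ge> 0" unfolding a_b_c_def by auto
  have q: "0 \<le> a * s\<^sup>2 - 2 * b * s * t + c * t\<^sup>2" for s t :: real
  proof -
    have "0 \<le> (LINT x|I_pi. (s * cmod (f x) - t * cmod (g x))\<^sup>2)" by simp
    also have "\<dots> = (LINT x|I_pi. s\<^sup>2 * (cmod (f x))\<^sup>2 - 2 * s * t * cmod (f x * g x) + t\<^sup>2 * (cmod (g x))\<^sup>2)"
      by (intro Bochner_Integration.integral_cong) (auto simp: power2_eq_square norm_mult algebra_simps)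
    also have "\<dots> = s\<^sup>2 * a - 2 * s * t * b + t\<^sup>2 * c"
      unfolding a_b_c_def using int by simp
    finally show ?thesis by (simp add: algebra_simps)
  qed
  have "b\<^sup>2 \<le> a * c"
  proof (cases "c = 0")
    case True
    have "b = 0"
    proof (rule ccontr)
      assume "b \<noteq> 0"
      \<comment> \<open>With \<open>c = 0\<close> the form is linear in \<open>t\<close>; this
        \<open>t\<close> gives it the value \<open>a - (a + 1) = -1\<close>.\<close>
      then show False using q[of 1 "(a + 1) / (2 * b)"] True nn by (simp add: field_simps)
    qed
    then show ?thesis using nn by simp
  next
    case False
    then have "0 \<le> c * (a * c - b\<^sup>2)" using q[of c b] by (simp add: power2_eq_square algebra_simps)
    then show ?thesis using False nn by (simp add: zero_le_mult_iff)
  qed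
  then have "sqrt (b\<^sup>2) \<le> sqrt (a * c)" by (rule real_sqrt_le_mono)
  then show ?thesis using nn unfolding a_b_c_def by (simp add: real_sqrt_mult)
qed

lemma H0_norm_nonneg: "0 \<le> H0_norm f"
  unfolding H0_norm_def by simp

lemma L1_norm_le_H0_norm:
  assumes "L2 f" 
  shows "(LINT x|I_pi. cmod (f x)) \<le> pi * H0_norm f"
proof -
  have "(LINT x|I_pi. cmod (f x)) \<le> sqrt (LINT x|I_pi. (cmod (f x))\<^sup>2) * sqrt pi"
    using L2_Cauchy_Schwarz[OF assms L2_continuous[of "\<lambda>_. 1"]] LINT_const_I_pi[of 1]
    by (simp del: lebesgue_integral_const)
  also have "\<dots> = pi * H0_norm f"
    unfolding H0_norm_def real_sqrt_divide using real_div_sqrt[of pi]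
    by (metis less_eq_real_def mult.commute pi_gt_zero times_divide_eq_left times_divide_eq_right)
  finally show ?thesis .
qed

lemma norm_integral_le_L1:
  fixes f :: "real \<Rightarrow> complex"
  assumes "integrable I_pi f" "x \<in> {0..pi}"
  shows "cmod (integral {0..x} f) \<le> (LINT x|I_pi. cmod (f x))"
proof -
  have "cmod (integral {0..x} f) \<le> integral {0..x} (\<lambda>t. cmod (f t))"
    by (rule norm_integral_le_integral) (use assms in auto)
  also have "\<dots> \<le> integral {0..pi} (\<lambda>t. cmod (f t))"
    using assms by (intro integral_subset_le integrable_I_pi_subinterval(3)) auto
  also have "\<dots> = (LINT x|I_pi. cmod (f x))"
    using assms by (subst integrable_I_pi_subinterval(4)) auto
  finally show ?thesis .
qed

lemma H0_norm_le_sup: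
  assumes "\<And>x. x \<in> {0..pi} \<Longrightarrow> cmod (f x) \<le> B" "L2 f" "B \<ge> 0"
  shows "H0_norm f \<le> B"
proof -
  have "(LINT x|I_pi. (cmod (f x))\<^sup>2) \<le> (LINT x|I_pi. B\<^sup>2)"
    using assms unfolding L2_def by (intro integral_mono) (auto intro!: power_mono finite_measure.integrable_const finite_measure_lebesgue_on)
  then have "(LINT x|I_pi. (cmod (f x))\<^sup>2) / pi \<le> B\<^sup>2" 
    unfolding LINT_const_I_pi by (simp add: divide_le_eq mult.commute)
  then show ?thesis unfolding H0_norm_def using assms(3) by (simp add: real_le_lsqrt)
qed

text \<open>A substitute for the triangle inequality: the factor 2 does no harm in limits, and two
  summands below \<open>\<epsilon> / 2\<close> still give a sum below
  \<open>\<epsilon>\<close>.\<close>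

lemma H0_norm_add_sq_le:
  assumes "L2 f" "L2 g"
  shows "(H0_norm (\<lambda>x. f x + g x))\<^sup>2 \<le> 2 * (H0_norm f)\<^sup>2 + 2 * (H0_norm g)\<^sup>2"
proof -
  have "(LINT x|I_pi. (cmod (f x + g x))\<^sup>2) \<le> (LINT x|I_pi. 2 * (cmod (f x))\<^sup>2 + 2 * (cmod (g x))\<^sup>2)"
  proof (rule integral_mono)
    show "integrable I_pi (\<lambda>x. (cmod (f x + g x))\<^sup>2)" "integrable I_pi (\<lambda>x. 2 * (cmod (f x))\<^sup>2 + 2 * (cmod (g x))\<^sup>2)"
      using assms L2_add[OF assms] unfolding L2_def by auto
    fix x
    have "(cmod (f x + g x))\<^sup>2 \<le> (cmod (f x) + cmod (g x))\<^sup>2" by (intro power_mono norm_triangle_ineq) auto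
    also have "\<dots> \<le> 2 * (cmod (f x))\<^sup>2 + 2 * (cmod (g x))\<^sup>2"
      using sum_squares_bound[of "cmod (f x)" "cmod (g x)"] by (simp add: power2_sum)
    finally show "(cmod (f x + g x))\<^sup>2 \<le> 2 * (cmod (f x))\<^sup>2 + 2 * (cmod (g x))\<^sup>2" .
  qed
  also have "\<dots> = 2 * (LINT x|I_pi. (cmod (f x))\<^sup>2) + 2 * (LINT x|I_pi. (cmod (g x))\<^sup>2)"
    using assms unfolding L2_def by simp
  finally show ?thesis unfolding H0_norm_def by (simp add: field_simps)
qed

lemma H0_norm_cmult: "H0_norm (\<lambda>x. c * f x) = cmod c * H0_norm f"
  unfolding H0_norm_def by (simp add: norm_mult power_mult_distrib real_sqrt_mult real_sqrt_divide)

lemma H0_norm_eq_0_iff: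
  assumes "L2 f"
  shows "H0_norm f = 0 \<longleftrightarrow> ae_eq f (\<lambda>_. 0)"
  using assms unfolding H0_norm_def ae_eq_def L2_def
  by (simp add: integral_nonneg_eq_0_iff_AE)

lemma ae_eq_0_continuous:
  assumes "ae_eq f (\<lambda>_. 0)" "continuous_on {0..pi} f" "x \<in> {0..pi}"
  shows "f x = 0"
proof -
  have "AE x in I_pi. (cmod (f x))\<^sup>2 = 0" using assms(1) unfolding ae_eq_def by auto
  then have "(LINT x|I_pi. (cmod (f x))\<^sup>2) = 0"
    by (subst integral_cong_AE[of _ _ "\<lambda>_. 0"]) (use measurable_continuous_I_pi[OF assms(2)] in auto)
  moreover have c: "continuous_on {0..pi} (\<lambda>x. (cmod (f x))\<^sup>2)" using assms by (intro continuous_intros)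
  ultimately have "integral {0..pi} (\<lambda>x. (cmod (f x))\<^sup>2) = 0"
    using integrable_I_pi_subinterval(4)[OF integrable_continuous_I_pi[OF c], of 0 pi] by simp
  then have "(cmod (f x))\<^sup>2 = 0"
    using integral_eq_0_iff[OF c] assms(3) pi_gt_zero by auto
  then show ?thesis by simp
qed

section \<open>The first-order system\<close>

lemma integral_Pair_I_pi:
  fixes f g :: "real \<Rightarrow> complex"
  assumes f: "integrable I_pi f" and g: "integrable I_pi g"
  shows "integrable I_pi (\<lambda>t. (f t, g t))"
    and "x \<in> {0..pi} \<Longrightarrow> integral {0..x} (\<lambda>t. (f t, g t)) = (integral {0..x} f, integral {0..x} g)"
proof -
  have bl: "bounded_linear (\<lambda>z::complex. (z, 0::complex))" "bounded_linear (\<lambda>z::complex. (0::complex, z))"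
    by (intro bounded_linear_Pair bounded_linear_ident bounded_linear_zero)+
  have "integrable I_pi (\<lambda>t. (f t, 0) + (0, g t))"
    using f g by (intro Bochner_Integration.integrable_add integrable_bounded_linear[OF bl(1)] integrable_bounded_linear[OF bl(2)])
  then show int: "integrable I_pi (\<lambda>t. (f t, g t))" by simp
  assume x: "x \<in> {0..pi}"
  have i: "(\<lambda>t. (f t, g t)) integrable_on {0..x}" "f integrable_on {0..x}" "g integrable_on {0..x}"
    using int f g x by (auto intro!: integrable_I_pi_subinterval(2))
  have "fst (integral {0..x} (\<lambda>t. (f t, g t))) = integral {0..x} f"
    using integral_linear[OF i(1) bounded_linear_fst] by (simp add: o_def)
  moreover have "snd (integral {0..x} (\<lambda>t. (f t, g t))) = integral {0..x} g"
    using integral_linear[OF i(1) bounded_linear_snd] by (simp add: o_def)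
  ultimately show "integral {0..x} (\<lambda>t. (f t, g t)) = (integral {0..x} f, integral {0..x} g)"
    by (simp add: prod_eq_iff)
qed

text \<open>Integrated form with arbitrary forcing \<open>a\<close>, \<open>b\<close>: constants
  encode initial values, \<open>c - integral {0..x} f\<close> encodes a right-hand side
  \<open>f\<close> together with the free value \<open>u 0 = c\<close>, and a nonconstant
  \<open>a\<close> records the defect of an approximate solution in the density proof.\<close>

definition qd_system :: "(real \<Rightarrow> complex) \<Rightarrow> complex \<Rightarrow> complex \<Rightarrow> (real \<Rightarrow> complex) \<Rightarrow> (real \<Rightarrow> complex) \<Rightarrow>
    (real \<Rightarrow> complex) \<Rightarrow> (real \<Rightarrow> complex) \<Rightarrow> bool" where
  "qd_system Q C lam a b y u \<longleftrightarrow> continuous_on {0..pi} y \<and> continuous_on {0..pi} u \<and>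
     (\<forall>x\<in>{0..pi}. y x = a x + integral {0..x} (\<lambda>t. Q t * y t + u t) \<and>
        u x = b x + integral {0..x} (\<lambda>t. (C - lam - (Q t)\<^sup>2) * y t - Q t * u t))"

locale L2_potential =
  fixes Q :: "real \<Rightarrow> complex" and C :: complex
  assumes L2_Q: "L2 Q"
begin

abbreviation "sys \<equiv> qd_system Q C"

lemma integrable_Q: "integrable I_pi Q"
  using L2_Q by (rule L2_integrable)

lemma integrable_Q_sq: "integrable I_pi (\<lambda>t. (Q t)\<^sup>2)"
  using L2_mult_integrable[OF L2_Q L2_Q] by (simp add: power2_eq_square)

lemma integrable_rhs:
  assumes "continuous_on {0..pi} y" "continuous_on {0..pi} u"
  shows "integrable I_pi (\<lambda>t. Q t * y t + u t)"
    and "integrable I_pi (\<lambda>t. (C - lam - (Q t)\<^sup>2) * y t - Q t * u t)"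
proof -
  have 1: "integrable I_pi (\<lambda>t. y t * Q t)" "integrable I_pi (\<lambda>t. u t * Q t)" "integrable I_pi (\<lambda>t. y t * (Q t)\<^sup>2)"
    using assms integrable_Q integrable_Q_sq by (auto intro: integrable_continuous_mult)
  have 2: "integrable I_pi u" "integrable I_pi (\<lambda>t. (C - lam) * y t)"
    using assms by (auto intro!: integrable_continuous_I_pi continuous_on_mult)
  have "integrable I_pi (\<lambda>t. y t * Q t + u t)" using 1 2 by (intro Bochner_Integration.integrable_add)
  then show "integrable I_pi (\<lambda>t. Q t * y t + u t)" by (simp add: mult.commute)
  have "integrable I_pi (\<lambda>t. (C - lam) * y t - y t * (Q t)\<^sup>2 - u t * Q t)" using 1 2 by (intro Bochner_Integration.integrable_diff)
  then show "integrable I_pi (\<lambda>t. (C - lam - (Q t)\<^sup>2) * y t - Q t * u t)" by (simp add: algebra_simps)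
qed

text \<open>Sum of bounds for the moduli of the four entries of the coefficient matrix, hence a
  bound for its operator norm; integrable because \<open>Q\<close> is square integrable.\<close>

definition coeff_norm :: "complex \<Rightarrow> real \<Rightarrow> real" where
  "coeff_norm lam t = 2 * cmod (Q t) + 1 + cmod C + cmod lam + (cmod (Q t))\<^sup>2"

lemma coeff_norm: "integrable I_pi (coeff_norm lam)" "0 \<le> coeff_norm lam t"
proof -
  have "integrable I_pi (\<lambda>t. (2 * cmod (Q t) + (1 + cmod C + cmod lam)) + (cmod (Q t))\<^sup>2)"
    using integrable_Q L2_Q[unfolded L2_def]
    by (intro Bochner_Integration.integrable_add integrable_mult_right integrable_norm
        integrable_continuous_I_pi[of "\<lambda>_. (1::real)"] integrable_continuous_I_pi[of "\<lambda>_. cmod _"] continuous_on_const) blast+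
  then show "integrable I_pi (coeff_norm lam)" unfolding coeff_norm_def by (simp add: add_ac)
qed (simp add: coeff_norm_def)

text \<open>The factor \<open>2 * exp\<close> of \<open>volterra_bound\<close>, with another 2 for
  the norm of the pair \<open>(a, b)\<close>.\<close>

definition sys_const :: "complex \<Rightarrow> real" where
  "sys_const lam = 4 * exp (2 * integral {0..pi} (coeff_norm lam))"

lemma sys_const_pos: "0 < sys_const lam"
  unfolding sys_const_def by simp

definition sys_matrix :: "complex \<Rightarrow> real \<Rightarrow> complex \<times> complex \<Rightarrow> complex \<times> complex" where
  "sys_matrix lam t p = (Q t * fst p + snd p, (C - lam - (Q t)\<^sup>2) * fst p - Q t * snd p)"

lemma sys_matrix_diff: "sys_matrix lam t p - sys_matrix lam t q = sys_matrix lam t (p - q)"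
  unfolding sys_matrix_def by (simp add: algebra_simps)

lemma norm_sys_matrix_le: "norm (sys_matrix lam t p) \<le> coeff_norm lam t * norm p"
proof -
  define n where "n = norm p"
  have n: "cmod (fst p) \<le> n" "cmod (snd p) \<le> n" unfolding n_def using norm_fst_le[of "fst p" "snd p"] norm_snd_le[of "snd p" "fst p"] by auto
  have "norm (sys_matrix lam t p) \<le> cmod (Q t * fst p + snd p) + cmod ((C - lam - (Q t)\<^sup>2) * fst p - Q t * snd p)"
    unfolding sys_matrix_def by (rule norm_Pair_le)
  also have "\<dots> \<le> (cmod (Q t) * cmod (fst p) + cmod (snd p)) + (cmod (C - lam - (Q t)\<^sup>2) * cmod (fst p) + cmod (Q t) * cmod (snd p))"
    unfolding norm_mult[symmetric] by (intro add_mono norm_triangle_ineq norm_triangle_ineq4)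
  also have "\<dots> \<le> (cmod (Q t) * n + n) + ((cmod C + cmod lam + (cmod (Q t))\<^sup>2) * n + cmod (Q t) * n)"
  proof (intro add_mono mult_mono n order_refl)
    show "cmod (C - lam - (Q t)\<^sup>2) \<le> cmod C + cmod lam + (cmod (Q t))\<^sup>2"
      unfolding norm_power[symmetric] by (intro order_trans[OF norm_triangle_ineq4] add_mono norm_triangle_ineq4 order_refl)
  qed auto
  also have "\<dots> = coeff_norm lam t * n" unfolding coeff_norm_def by (simp add: algebra_simps)
  finally show ?thesis unfolding n_def .
qed

lemma sys_exists:
  assumes "continuous_on {0..pi} a" "continuous_on {0..pi} b"
  obtains y u where "sys lam a b y u"
proof -
  have int: "integrable I_pi (\<lambda>t. sys_matrix lam t (Y t))" if "continuous_on {0..pi} Y" for Y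
    unfolding sys_matrix_def using that by (intro integral_Pair_I_pi(1) integrable_rhs continuous_on_fst continuous_on_snd)
  have lip: "norm (sys_matrix lam t x - sys_matrix lam t y) \<le> coeff_norm lam t * norm (x - y)" for t x y
    unfolding sys_matrix_diff by (rule norm_sys_matrix_le)
  have "continuous_on {0..pi} (\<lambda>x. (a x, b x))" using assms by (rule continuous_on_Pair)
  then obtain Y where Y: "continuous_on {0..pi} Y"
    and eq: "\<And>x. x \<in> {0..pi} \<Longrightarrow> Y x = (a x, b x) + integral {0..x} (\<lambda>t. sys_matrix lam t (Y t))"
    using volterra_solution_exists[OF coeff_norm int lip] by blast
  have c: "continuous_on {0..pi} (\<lambda>x. fst (Y x))" "continuous_on {0..pi} (\<lambda>x. snd (Y x))"
    using Y by (auto intro: continuous_on_fst continuous_on_snd)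
  have "sys lam a b (\<lambda>x. fst (Y x)) (\<lambda>x. snd (Y x))"
    unfolding qd_system_def
  proof (intro conjI ballI c)
    fix x assume x: "x \<in> {0..pi}"
    have "Y x = (a x + integral {0..x} (\<lambda>t. Q t * fst (Y t) + snd (Y t)),
       b x + integral {0..x} (\<lambda>t. (C - lam - (Q t)\<^sup>2) * fst (Y t) - Q t * snd (Y t)))"
      using eq[OF x] unfolding sys_matrix_def integral_Pair_I_pi(2)[OF integrable_rhs(1)[OF c] integrable_rhs(2)[OF c] x] by simp
    then show "fst (Y x) = a x + integral {0..x} (\<lambda>t. Q t * fst (Y t) + snd (Y t))"
      "snd (Y x) = b x + integral {0..x} (\<lambda>t. (C - lam - (Q t)\<^sup>2) * fst (Y t) - Q t * snd (Y t))"
      by (simp_all add: prod_eq_iff)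
  qed
  then show ?thesis by (rule that)
qed

lemma sys_bound:
  assumes s: "sys lam a b y u"
    and G: "\<And>x. x \<in> {0..pi} \<Longrightarrow> cmod (a x) \<le> G" "\<And>x. x \<in> {0..pi} \<Longrightarrow> cmod (b x) \<le> G"
    and x: "x \<in> {0..pi}"
  shows "cmod (y x) \<le> sys_const lam * G" "cmod (u x) \<le> sys_const lam * G"
proof -
  have c: "continuous_on {0..pi} y" "continuous_on {0..pi} u" using s unfolding qd_system_def by auto
  have "norm (y x, u x) \<le> 2 * (2 * G) * exp (2 * integral {0..pi} (coeff_norm lam))"
  proof (rule volterra_bound[OF coeff_norm _ _ _ _ _ x, of "\<lambda>x. (y x, u x)" "\<lambda>t. sys_matrix lam t (y t, u t)" _ "\<lambda>x. (a x, b x)"])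
    show "continuous_on {0..pi} (\<lambda>x. (y x, u x))" using c by (rule continuous_on_Pair)
    show "integrable I_pi (\<lambda>t. sys_matrix lam t (y t, u t))"
      unfolding sys_matrix_def fst_conv snd_conv using c by (intro integral_Pair_I_pi(1) integrable_rhs)
    show "norm (sys_matrix lam t (y t, u t)) \<le> coeff_norm lam t * norm (y t, u t)" for t by (rule norm_sys_matrix_le)
    fix x assume x: "x \<in> {0..pi}"
    show "(y x, u x) = (a x, b x) + integral {0..x} (\<lambda>t. sys_matrix lam t (y t, u t))"
      using s x unfolding sys_matrix_def fst_conv snd_conv qd_system_def
      by (subst integral_Pair_I_pi(2)) (auto intro: integrable_rhs)
    show "norm (a x, b x) \<le> 2 * G" using G[OF x] norm_Pair_le[of "a x" "b x"] by simp
  qed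
  then have "norm (y x, u x) \<le> sys_const lam * G" unfolding sys_const_def by (simp add: mult_ac)
  moreover have "cmod (y x) \<le> norm (y x, u x)" "cmod (u x) \<le> norm (y x, u x)"
    by (rule norm_fst_le norm_snd_le)+
  ultimately show "cmod (y x) \<le> sys_const lam * G" "cmod (u x) \<le> sys_const lam * G" by auto
qed

lemma sys_cong:
  assumes "sys lam a b y u" "\<And>x. x \<in> {0..pi} \<Longrightarrow> a x = a' x" "\<And>x. x \<in> {0..pi} \<Longrightarrow> b x = b' x"
  shows "sys lam a' b' y u"
  using assms unfolding qd_system_def by auto

lemma sys_add_scaled:
  assumes "sys lam a b y u" "sys lam a' b' y' u'"
  shows "sys lam (\<lambda>x. a x + c * a' x) (\<lambda>x. b x + c * b' x) (\<lambda>x. y x + c * y' x) (\<lambda>x. u x + c * u' x)"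
proof -
  have s: "continuous_on {0..pi} y" "continuous_on {0..pi} u" "continuous_on {0..pi} y'" "continuous_on {0..pi} u'"
    using assms unfolding qd_system_def by auto
  show ?thesis unfolding qd_system_def
  proof (intro conjI ballI)
    show "continuous_on {0..pi} (\<lambda>x. y x + c * y' x)" "continuous_on {0..pi} (\<lambda>x. u x + c * u' x)"
      using s by (auto intro!: continuous_on_add continuous_on_mult)
    fix x assume x: "x \<in> {0..pi}"
    have "integral {0..x} (\<lambda>t. Q t * (y t + c * y' t) + (u t + c * u' t)) =
      integral {0..x} (\<lambda>t. (Q t * y t + u t) + c * (Q t * y' t + u' t))"
      by (intro arg_cong[where f="integral _"] ext) (simp add: algebra_simps)
    also have "\<dots> = integral {0..x} (\<lambda>t. Q t * y t + u t) + c * integral {0..x} (\<lambda>t. Q t * y' t + u' t)"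
      using x s by (subst Henstock_Kurzweil_Integration.integral_add) (auto intro!: integrable_I_pi_subinterval(2) integrable_rhs integrable_mult_right)
    finally show "y x + c * y' x = a x + c * a' x + integral {0..x} (\<lambda>t. Q t * (y t + c * y' t) + (u t + c * u' t))"
      using assms x unfolding qd_system_def by (simp add: algebra_simps)
    have "integral {0..x} (\<lambda>t. (C - lam - (Q t)\<^sup>2) * (y t + c * y' t) - Q t * (u t + c * u' t)) =
      integral {0..x} (\<lambda>t. ((C - lam - (Q t)\<^sup>2) * y t - Q t * u t) + c * ((C - lam - (Q t)\<^sup>2) * y' t - Q t * u' t))"
      by (intro arg_cong[where f="integral _"] ext) (simp add: algebra_simps)
    also have "\<dots> = integral {0..x} (\<lambda>t. (C - lam - (Q t)\<^sup>2) * y t - Q t * u t) + c * integral {0..x} (\<lambda>t. (C - lam - (Q t)\<^sup>2) * y' t - Q t * u' t)"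
      using x s by (subst Henstock_Kurzweil_Integration.integral_add) (auto intro!: integrable_I_pi_subinterval(2) integrable_rhs integrable_mult_right)
    finally show "u x + c * u' x = b x + c * b' x + integral {0..x} (\<lambda>t. (C - lam - (Q t)\<^sup>2) * (y t + c * y' t) - Q t * (u t + c * u' t))"
      using assms x unfolding qd_system_def by (simp add: algebra_simps)
  qed
qed

lemma sys_unique:
  assumes "sys lam a b y u" "sys lam a b y' u'" "x \<in> {0..pi}"
  shows "y x = y' x" "u x = u' x"
proof -
  have "sys lam (\<lambda>_. 0) (\<lambda>_. 0) (\<lambda>x. y x + (-1) * y' x) (\<lambda>x. u x + (-1) * u' x)"
    by (rule sys_cong[OF sys_add_scaled[OF assms(1,2)]]) auto
  from sys_bound[OF this, of 0 x] assms(3) show "y x = y' x" "u x = u' x" by auto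
qed

text \<open>Changing the spectral parameter only changes the forcing, so that solutions at two
  parameters can be compared through the a priori bound at one of them.\<close>

lemma sys_shift:
  assumes "sys lam a b y u"
  shows "sys mu a (\<lambda>x. b x - (lam - mu) * integral {0..x} y) y u"
  unfolding qd_system_def
proof (intro conjI ballI)
  show c: "continuous_on {0..pi} y" "continuous_on {0..pi} u" using assms unfolding qd_system_def by auto
  fix x assume x: "x \<in> {0..pi}"
  show "y x = a x + integral {0..x} (\<lambda>t. Q t * y t + u t)" using assms x unfolding qd_system_def by auto
  have i: "integral {0..x} (\<lambda>t. (C - mu - (Q t)\<^sup>2) * y t - Q t * u t - (lam - mu) * y t) =
    integral {0..x} (\<lambda>t. (C - mu - (Q t)\<^sup>2) * y t - Q t * u t) - (lam - mu) * integral {0..x} y"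
    using x c integrable_I_pi_subinterval(2)[OF integrable_rhs(2)[OF c, of mu], of 0 x]
      integrable_I_pi_subinterval(2)[OF integrable_continuous_I_pi[OF c(1)], of 0 x]
    by (subst Henstock_Kurzweil_Integration.integral_diff) (auto intro: integrable_on_mult_right)
  have "integral {0..x} (\<lambda>t. (C - lam - (Q t)\<^sup>2) * y t - Q t * u t) = integral {0..x} (\<lambda>t. (C - mu - (Q t)\<^sup>2) * y t - Q t * u t - (lam - mu) * y t)"
    by (intro arg_cong[where f="integral _"] ext) (simp add: algebra_simps)
  with i show "u x = b x - (lam - mu) * integral {0..x} y + integral {0..x} (\<lambda>t. (C - mu - (Q t)\<^sup>2) * y t - Q t * u t)"
    using assms x unfolding qd_system_def by auto
qed

end

section \<open>The Dirichlet problem, its resolvent and its spectrum\<close>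

lemma integral_cong_AE_I_pi:
  fixes f g :: "real \<Rightarrow> 'a::euclidean_space"
  assumes "AE x in I_pi. f x = g x" "x \<in> {0..pi}"
  shows "integral {0..x} f = integral {0..x} g"
proof -
  have "AE t in lebesgue. t \<in> {0..pi} \<longrightarrow> f t = g t"
    using assms(1) by (subst (asm) AE_restrict_space_iff) auto
  then obtain N where N: "N \<in> null_sets lebesgue" "{t. \<not> (t \<in> {0..pi} \<longrightarrow> f t = g t)} \<subseteq> N"
    unfolding eventually_ae_filter by auto
  have "negligible N" using N(1) by (simp add: negligible_iff_null_sets)
  then show ?thesis
    by (rule integral_spike) (use N(2) assms(2) in auto)
qed

text \<open>\<open>LDir\<close> holds \<open>y\<close> to its continuous representative on
  \<open>[0,pi]\<close>, whereas \<open>f\<close> matters only as a class; hence \<open>f\<close>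
  alone is altered on a null set.\<close>

lemma LDir_cong_AE:
  assumes "LDir Q C y f" "ae_eq f' f"
  shows "LDir Q C y f'"
proof -
  obtain y' z w where *: "L2 y'" "prim y y'" "L1 w" "prim z w"
    "ae_eq z (\<lambda>x. y' x - Q x * y x)" "y 0 = 0" "y pi = 0" "L2 f"
    "ae_eq f (\<lambda>x. - w x - Q x * y' x + C * y x)"
    using assms(1) unfolding LDir_def by blast
  have "ae_eq f' (\<lambda>x. - w x - Q x * y' x + C * y x)"
    using *(9) assms(2) unfolding ae_eq_def by eventually_elim simp
  moreover have "L2 f'" using *(8) assms(2) by (rule L2_cong_AE)
  ultimately show ?thesis using * unfolding LDir_def by blast
qed

context L2_potential
begin

text \<open>A solution is determined only on \<open>[0,pi]\<close>, its values elsewhere being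
  arbitrary, hence a choice rather than a description.\<close>

definition sol2 :: "complex \<Rightarrow> (real \<Rightarrow> complex) \<times> (real \<Rightarrow> complex)" where
  "sol2 lam = (SOME p. sys lam (\<lambda>_. 0) (\<lambda>_. 1) (fst p) (snd p))"

abbreviation "y2 lam \<equiv> fst (sol2 lam)"
abbreviation "u2 lam \<equiv> snd (sol2 lam)"

lemma sys_sol2: "sys lam (\<lambda>_. 0) (\<lambda>_. 1) (y2 lam) (u2 lam)"
proof -
  obtain y u where "sys lam (\<lambda>_. 0) (\<lambda>_. 1) y u"
    using sys_exists[of "\<lambda>_. 0" "\<lambda>_. 1" lam] by auto
  then have "sys lam (\<lambda>_. 0) (\<lambda>_. 1) (fst (y, u)) (snd (y, u))" by simp
  then show ?thesis unfolding sol2_def by (rule someI)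
qed

lemma sys_continuous:
  assumes "sys lam a b y u"
  shows "continuous_on {0..pi} y" "continuous_on {0..pi} u"
  using assms unfolding qd_system_def by auto

lemma is_sol2_iff: "is_sol2 Q C lam y u \<longleftrightarrow> sys lam (\<lambda>_. 0) (\<lambda>_. 1) y u"
proof (cases "continuous_on {0..pi} y \<and> continuous_on {0..pi} u")
  case True
  then have i: "integrable I_pi (\<lambda>t. Q t * y t + u t)" "integrable I_pi (\<lambda>t. (C - lam - (Q t)\<^sup>2) * y t - Q t * u t)"
    using integrable_rhs by auto
  have e: "integral\<^sup>L (lebesgue_on {0..x}) (\<lambda>t. Q t * y t + u t) = integral {0..x} (\<lambda>t. Q t * y t + u t)"
    "integral\<^sup>L (lebesgue_on {0..x}) (\<lambda>t. (C - lam - (Q t)\<^sup>2) * y t - Q t * u t) = integral {0..x} (\<lambda>t. (C - lam - (Q t)\<^sup>2) * y t - Q t * u t)"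
    if "x \<in> {0..pi}" for x
    using that by (auto intro!: integrable_I_pi_subinterval(4) i)
  show ?thesis unfolding is_sol2_def qd_system_def L1_def using True i e by simp
next
  case False
  then show ?thesis unfolding is_sol2_def qd_system_def by auto
qed

lemma y2_pi_eq: "y2_pi Q C lam = y2 lam pi"
  unfolding y2_pi_def is_sol2_iff
proof (rule the_equality)
  show "\<exists>y u. sys lam (\<lambda>_. 0) (\<lambda>_. 1) y u \<and> y pi = y2 lam pi" using sys_sol2 by blast
  fix w assume "\<exists>y u. sys lam (\<lambda>_. 0) (\<lambda>_. 1) y u \<and> y pi = w"
  then show "w = y2 lam pi" using sys_unique(1)[OF _ sys_sol2, of lam _ _ pi] by auto
qed

text \<open>The representative \<open>z\<close> of \<open>y' - Qy\<close> serves as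
  \<open>u\<close>; substituting \<open>y' = Qy + u\<close> in \<open>Qy'\<close> produces the
  \<open>Q^2\<close> term. The constant \<open>c = z 0\<close> is free because the boundary
  conditions say nothing about \<open>u\<close>.\<close>

lemma LDir_imp_sys:
  assumes "LDir Q C y (\<lambda>x. f x + lam * y x)" "L2 f"
  obtains c u where "sys lam (\<lambda>_. 0) (\<lambda>x. c - integral {0..x} f) y u" "y 0 = 0" "y pi = 0"
proof -
  obtain y' z w where *: "L2 y'" "prim y y'" "L1 w" "prim z w"
    "ae_eq z (\<lambda>x. y' x - Q x * y x)" "y 0 = 0" "y pi = 0" 
    and w: "ae_eq (\<lambda>x. f x + lam * y x) (\<lambda>x. - w x - Q x * y' x + C * y x)"
    using assms(1) unfolding LDir_def by blast
  have i: "integrable I_pi y'" "integrable I_pi w" "integrable I_pi f"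
    using L2_integrable[OF *(1)] *(3) L2_integrable[OF assms(2)] unfolding L1_def by auto
  have y: "y x = integral {0..x} y'" and z: "z x = z 0 + integral {0..x} w" if "x \<in> {0..pi}" for x
    using *(2,4) *(6) that integrable_I_pi_subinterval(4)[OF i(1), of 0 x] integrable_I_pi_subinterval(4)[OF i(2), of 0 x]
    unfolding prim_def by fastforce+
  have c: "continuous_on {0..pi} y" "continuous_on {0..pi} z"
    by (rule continuous_on_eq[OF continuous_on_integral_I_pi[OF i(1)]], simp only: y,
        rule continuous_on_eq[OF continuous_on_add[OF continuous_on_const[of _ "z 0"] continuous_on_integral_I_pi[OF i(2)]]], rule z[symmetric])
  have "sys lam (\<lambda>_. 0) (\<lambda>x. z 0 - integral {0..x} f) y z"
    unfolding qd_system_def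
  proof (intro conjI ballI c)
    fix x assume x: "x \<in> {0..pi}"
    have "AE t in I_pi. y' t = Q t * y t + z t"
      using *(5) unfolding ae_eq_def by (rule eventually_mono) auto
    then show "y x = 0 + integral {0..x} (\<lambda>t. Q t * y t + z t)"
      using y[OF x] integral_cong_AE_I_pi x by fastforce
    have "AE t in I_pi. w t = ((C - lam - (Q t)\<^sup>2) * y t - Q t * z t) - f t"
      using *(5) w unfolding ae_eq_def
    proof eventually_elim
      case (elim t)
      then have "y' t = Q t * y t + z t" by simp
      moreover have "w t = - Q t * y' t + C * y t - f t - lam * y t" using elim(2) by (simp add: algebra_simps)
      ultimately show ?case by (simp add: algebra_simps power2_eq_square)
    qed
    then have "integral {0..x} w = integral {0..x} (\<lambda>t. ((C - lam - (Q t)\<^sup>2) * y t - Q t * z t) - f t)"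
      using x by (rule integral_cong_AE_I_pi)
    also have "\<dots> = integral {0..x} (\<lambda>t. (C - lam - (Q t)\<^sup>2) * y t - Q t * z t) - integral {0..x} f"
      using x i c by (intro Henstock_Kurzweil_Integration.integral_diff) (auto intro!: integrable_I_pi_subinterval(2) integrable_rhs)
    finally show "z x = z 0 - integral {0..x} f + integral {0..x} (\<lambda>t. (C - lam - (Q t)\<^sup>2) * y t - Q t * z t)"
      using z[OF x] by simp
  qed
  then show ?thesis using *(6,7) by (rule that)
qed

lemma sys_imp_LDir:
  assumes s: "sys lam (\<lambda>_. 0) (\<lambda>x. c - integral {0..x} f) y u" and y: "y pi = 0" and f: "L2 f"
  shows "LDir Q C y (\<lambda>x. f x + lam * y x)"
proof -
  note c = sys_continuous[OF s]
  define y' where "y' = (\<lambda>x. Q x * y x + u x)"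
  define w where "w = (\<lambda>x. ((C - lam - (Q x)\<^sup>2) * y x - Q x * u x) - f x)"
  have y': "L2 y'" 
    using L2_add[OF L2_continuous_mult[OF L2_Q c(1)] L2_continuous[OF c(2)]] unfolding y'_def by (simp add: mult.commute)
  have w: "integrable I_pi w" unfolding w_def using c L2_integrable[OF f] by (auto intro!: integrable_rhs)
  have s1: "y x = integral {0..x} y'" if "x \<in> {0..pi}" for x
    using s that unfolding qd_system_def y'_def by auto
  then have y0: "y 0 = 0" by simp
  have s2: "u x = c + integral {0..x} w" if "x \<in> {0..pi}" for x
  proof -
    have "integral {0..x} w = integral {0..x} (\<lambda>t. (C - lam - (Q t)\<^sup>2) * y t - Q t * u t) - integral {0..x} f"
      unfolding w_def using that L2_integrable[OF f] c
      by (intro Henstock_Kurzweil_Integration.integral_diff) (auto intro!: integrable_I_pi_subinterval(2) integrable_rhs)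
    then show ?thesis using s that unfolding qd_system_def by auto
  qed
  then have u0: "u 0 = c" by simp
  have "prim y y'" unfolding prim_def y0 using s1 L2_integrable[OF y'] by (auto simp: integrable_I_pi_subinterval(4))
  moreover have "prim u w" unfolding prim_def u0 using s2 w by (auto simp: integrable_I_pi_subinterval(4))
  moreover have "ae_eq u (\<lambda>x. y' x - Q x * y x)" unfolding ae_eq_def y'_def by simp
  moreover have "L2 (\<lambda>x. f x + lam * y x)" by (rule L2_add[OF f L2_cmult[OF L2_continuous[OF c(1)]]])
  moreover have "ae_eq (\<lambda>x. f x + lam * y x) (\<lambda>x. - w x - Q x * y' x + C * y x)"
    unfolding ae_eq_def y'_def w_def by (simp add: algebra_simps power2_eq_square)
  ultimately show ?thesis unfolding LDir_def L1_def using y' w y0 y by blast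
qed

lemma LDir_L2: "LDir Q C y f \<Longrightarrow> L2 f"
  unfolding LDir_def by blast

lemma LDir_continuous: 
  assumes "LDir Q C y f" 
  shows "continuous_on {0..pi} y"
proof -
  \<comment> \<open>Spectral parameter 0 brings an arbitrary right-hand side into the form that
    \<open>LDir_imp_sys\<close> expects.\<close>
  have "LDir Q C y (\<lambda>x. f x + 0 * y x)" using assms by simp
  then obtain c u where "sys 0 (\<lambda>_. 0) (\<lambda>x. c - integral {0..x} f) y u"
    using LDir_imp_sys[OF _ LDir_L2[OF assms]] by blast
  then show ?thesis by (rule sys_continuous)
qed

lemma LDir_add_scaled:
  assumes "LDir Q C y f" "LDir Q C y' f'"
  shows "LDir Q C (\<lambda>x. y x + k * y' x) (\<lambda>x. f x + k * f' x)"
proof -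
  note f = LDir_L2[OF assms(1)] LDir_L2[OF assms(2)]
  have "LDir Q C y (\<lambda>x. f x + 0 * y x)" "LDir Q C y' (\<lambda>x. f' x + 0 * y' x)" using assms by simp_all
  note h = this
  obtain c u where s1: "sys 0 (\<lambda>_. 0) (\<lambda>x. c - integral {0..x} f) y u" "y pi = 0"
    using LDir_imp_sys[OF h(1) f(1)] by blast
  obtain c' u' where s2: "sys 0 (\<lambda>_. 0) (\<lambda>x. c' - integral {0..x} f') y' u'" "y' pi = 0"
    using LDir_imp_sys[OF h(2) f(2)] by blast
  have "sys 0 (\<lambda>_. 0) (\<lambda>x. (c + k * c') - integral {0..x} (\<lambda>x. f x + k * f' x)) (\<lambda>x. y x + k * y' x) (\<lambda>x. u x + k * u' x)"
  proof (rule sys_cong[OF sys_add_scaled[OF s1(1) s2(1)]])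
    fix x assume "x \<in> {0..pi}"
    then have "integral {0..x} (\<lambda>x. f x + k * f' x) = integral {0..x} f + k * integral {0..x} f'"
      using f[THEN L2_integrable]
      by (subst Henstock_Kurzweil_Integration.integral_add) (auto intro!: integrable_I_pi_subinterval(2) integrable_mult_right)
    then show "c - integral {0..x} f + k * (c' - integral {0..x} f') = c + k * c' - integral {0..x} (\<lambda>x. f x + k * f' x)"
      by (simp add: algebra_simps)
  qed simp
  from sys_imp_LDir[OF this] show ?thesis using s1(2) s2(2) f by (simp add: L2_add L2_cmult)
qed

text \<open>The first summand bounds the solution after \<open>c * y2\<close> is subtracted, which
  removes the free constant from the forcing. The second bounds \<open>c * y2\<close>, since
  \<open>y pi = 0\<close> forces
  \<open>cmod c \<le> sys_const lam * G / cmod (y2 lam pi)\<close>.\<close>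

definition bvp_const :: "complex \<Rightarrow> real" where
  "bvp_const lam = sys_const lam * (1 + sys_const lam / cmod (y2 lam pi))"

lemma bvp_const_pos: "0 < bvp_const lam"
  unfolding bvp_const_def using sys_const_pos[of lam] by (intro mult_pos_pos add_pos_nonneg) auto

lemma bvp_bound:
  assumes n: "y2 lam pi \<noteq> 0" and s: "sys lam a (\<lambda>x. c + b x) y u" and y: "y pi = 0"
    and G: "\<And>x. x \<in> {0..pi} \<Longrightarrow> cmod (a x) \<le> G" "\<And>x. x \<in> {0..pi} \<Longrightarrow> cmod (b x) \<le> G"
    and x: "x \<in> {0..pi}"
  shows "cmod (y x) \<le> bvp_const lam * G"
proof -
  define K where "K = sys_const lam"
  have K: "K > 0" unfolding K_def by (rule sys_const_pos)
  have "sys lam a b (\<lambda>x. y x + (- c) * y2 lam x) (\<lambda>x. u x + (- c) * u2 lam x)"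
    by (rule sys_cong[OF sys_add_scaled[OF s sys_sol2]]) auto
  from sys_bound(1)[OF this G] have d: "cmod (y t - c * y2 lam t) \<le> K * G" if "t \<in> {0..pi}" for t
    using that unfolding K_def by simp
  have "cmod c * cmod (y2 lam pi) \<le> K * G" using d[of pi] y by (simp add: norm_mult)
  then have c: "cmod c \<le> K * G / cmod (y2 lam pi)" using n by (simp add: field_simps)
  have "cmod (y2 lam x) \<le> K" using sys_bound(1)[OF sys_sol2, of 1 x lam] x unfolding K_def by simp
  then have "cmod c * cmod (y2 lam x) \<le> K * G / cmod (y2 lam pi) * K" using c K by (intro mult_mono) (auto intro: order_trans[OF norm_ge_zero])
  moreover have "cmod (y x) \<le> cmod (y x - c * y2 lam x) + cmod c * cmod (y2 lam x)"
    using norm_triangle_sub[of "y x" "c * y2 lam x"] by (simp add: norm_mult add.commute)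
  ultimately have "cmod (y x) \<le> K * G + K * G / cmod (y2 lam pi) * K" using d[OF x] by linarith
  also have "\<dots> = bvp_const lam * G" unfolding bvp_const_def K_def by (simp add: algebra_simps)
  finally show ?thesis .
qed

text \<open>Shooting: adding a multiple of \<open>y2\<close> changes the forcing only by a constant
  and moves the value at \<open>pi\<close> to 0.\<close>

lemma bvp_exists:
  assumes n: "y2 lam pi \<noteq> 0" and "continuous_on {0..pi} a" "continuous_on {0..pi} b"
  obtains c y u where "sys lam a (\<lambda>x. c + b x) y u" "y pi = 0"
proof -
  obtain y u where s: "sys lam a b y u" using sys_exists assms by blast
  define c where "c = - y pi / y2 lam pi"
  have "sys lam a (\<lambda>x. c + b x) (\<lambda>x. y x + c * y2 lam x) (\<lambda>x. u x + c * u2 lam x)"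
    by (rule sys_cong[OF sys_add_scaled[OF s sys_sol2]]) auto
  moreover have "y pi + c * y2 lam pi = 0" unfolding c_def using n by simp
  ultimately show ?thesis by (rule that)
qed

lemma LDir_solvable:
  assumes "y2 lam pi \<noteq> 0" "L2 f"
  obtains y where "LDir Q C y (\<lambda>x. f x + lam * y x)"
proof -
  obtain c y u where "sys lam (\<lambda>_. 0) (\<lambda>x. c + - integral {0..x} f) y u" "y pi = 0"
    by (rule bvp_exists[OF assms(1) continuous_on_const[of _ 0]
          continuous_on_minus[OF continuous_on_integral_I_pi[OF L2_integrable[OF assms(2)]]]])
  then show ?thesis using sys_imp_LDir[of lam c f y u] assms(2) that by auto
qed

lemma LDir_sup_bound:
  assumes n: "y2 lam pi \<noteq> 0" and f: "L2 f" and y: "LDir Q C y (\<lambda>x. f x + lam * y x)" and x: "x \<in> {0..pi}"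
  shows "cmod (y x) \<le> bvp_const lam * (pi * H0_norm f)"
proof -
  obtain c u where s: "sys lam (\<lambda>_. 0) (\<lambda>x. c - integral {0..x} f) y u" "y pi = 0"
    using LDir_imp_sys[OF y f] by blast
  then have s': "sys lam (\<lambda>_. 0) (\<lambda>x. c + - integral {0..x} f) y u" by simp
  show ?thesis
  proof (rule bvp_bound[OF n s' s(2) _ _ x])
    fix t assume "t \<in> {0..pi}"
    then show "cmod (- integral {0..t} f) \<le> pi * H0_norm f"
      using order_trans[OF norm_integral_le_L1[OF L2_integrable[OF f]] L1_norm_le_H0_norm[OF f], of t] by simp
  qed (simp add: H0_norm_nonneg)
qed

lemma LDir_norm_bound:
  assumes "y2 lam pi \<noteq> 0" "L2 f" "LDir Q C y (\<lambda>x. f x + lam * y x)"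
  shows "H0_norm y \<le> bvp_const lam * pi * H0_norm f"
  using LDir_sup_bound[OF assms] bvp_const_pos[of lam] H0_norm_nonneg[of f]
  by (intro H0_norm_le_sup) (auto simp: mult.assoc intro: L2_continuous LDir_continuous[OF assms(3)])

text \<open>If \<open>y2\<close> vanished, so would the integral of \<open>u2\<close> over every
  \<open>[0,x]\<close>; differentiating at 0 contradicts \<open>u2 lam 0 = 1\<close>.\<close>

lemma y2_not_zero: "\<not> ae_eq (y2 lam) (\<lambda>_. 0)"
proof
  assume ae: "ae_eq (y2 lam) (\<lambda>_. 0)"
  note c = sys_continuous[OF sys_sol2[of lam]]
  have 0: "y2 lam x = 0" if "x \<in> {0..pi}" for x
    using ae_eq_0_continuous[OF ae c(1) that] .
  have int: "integral {0..x} (u2 lam) = 0" if "x \<in> {0..pi}" for x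
  proof -
    have "integral {0..x} (u2 lam) = integral {0..x} (\<lambda>t. Q t * y2 lam t + u2 lam t)"
      using 0 that by (intro Henstock_Kurzweil_Integration.integral_cong) auto
    then show ?thesis using sys_sol2[of lam] 0[OF that] that unfolding qd_system_def by auto
  qed
  have "((\<lambda>x. integral {0..x} (u2 lam)) has_vector_derivative u2 lam 0) (at 0 within {0..pi})"
    using c(2) by (rule integral_has_vector_derivative) auto
  moreover have "((\<lambda>x. integral {0..x} (u2 lam)) has_vector_derivative 0) (at 0 within {0..pi})"
    by (rule has_vector_derivative_transform[where f = "\<lambda>_. 0"]) (use int in auto)
  ultimately have "u2 lam 0 = 0"
    using vector_derivative_unique_within_closed_interval[of 0 pi 0] by auto
  moreover have "u2 lam 0 = 1" using sys_sol2[of lam] unfolding qd_system_def by auto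
  ultimately show False by simp
qed

lemma LDir_y2:
  assumes "y2 lam pi = 0"
  shows "LDir Q C (y2 lam) (\<lambda>x. lam * y2 lam x)"
proof -
  have "sys lam (\<lambda>_. 0) (\<lambda>x. 1 - integral {0..x} (\<lambda>_. 0)) (y2 lam) (u2 lam)" using sys_sol2 by simp
  from sys_imp_LDir[OF this assms] show ?thesis by (simp add: L2_continuous)
qed

lemma resolvent_set_iff: "lam \<in> resolvent_set Q C \<longleftrightarrow> y2 lam pi \<noteq> 0"
proof
  assume "lam \<in> resolvent_set Q C"
  then show "y2 lam pi \<noteq> 0" using LDir_y2 y2_not_zero unfolding resolvent_set_def by blast
next
  assume n: "y2 lam pi \<noteq> 0"
  show "lam \<in> resolvent_set Q C" unfolding resolvent_set_def
  proof (intro CollectI conjI allI impI)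
    show "\<exists>y. LDir Q C y (\<lambda>x. f x + lam * y x)" if "L2 f" for f
      using LDir_solvable[OF n that] by blast
    show "\<exists>M. \<forall>y f. L2 f \<and> LDir Q C y (\<lambda>x. f x + lam * y x) \<longrightarrow> H0_norm y \<le> M * H0_norm f"
      using LDir_norm_bound[OF n] by blast
    fix y assume y: "LDir Q C y (\<lambda>x. lam * y x)"
    \<comment> \<open>Injectivity is the norm bound for right-hand side 0.\<close>
    have "H0_norm (\<lambda>_. 0) = 0" unfolding H0_norm_def by simp
    then have "H0_norm y \<le> 0" using LDir_norm_bound[OF n L2_continuous, of "\<lambda>_. 0" y] y by simp
    then show "ae_eq y (\<lambda>x. 0)"
      using H0_norm_eq_0_iff[OF L2_continuous[OF LDir_continuous[OF y]]] H0_norm_nonneg[of y] by linarith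
  qed
qed

lemma spectrum_eq: "spectrum_op Q C = {lam. y2_pi Q C lam = 0}"
  unfolding spectrum_op_def y2_pi_eq using resolvent_set_iff by auto

lemma eigenvalue_of_zero: "y2 lam pi = 0 \<Longrightarrow> eigenvalue Q C lam"
  unfolding eigenvalue_def using LDir_y2 y2_not_zero by blast

end

section \<open>Coercivity and the existence of a regular point\<close>

lemma Young_sq: "2 * \<alpha> * \<beta> \<le> \<delta> * \<alpha>\<^sup>2 + \<beta>\<^sup>2 / \<delta>" if "\<delta> > 0" for \<alpha> \<beta> \<delta> :: real
proof -
  have "0 \<le> (\<delta> * \<alpha> - \<beta>)\<^sup>2 / \<delta>" using that by simp
  also have "\<dots> = \<delta> * \<alpha>\<^sup>2 + \<beta>\<^sup>2 / \<delta> - 2 * \<alpha> * \<beta>"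
    using that by (simp add: power2_eq_square field_simps)
  finally show ?thesis by simp
qed

context L2_potential
begin

text \<open>The quadratic form is coercive for large negative spectral parameter.\<close>
lemma y2_pi_nonzero_exists: "\<exists>lam. y2 lam pi \<noteq> 0"
proof -
  define q where "q = (LINT x|I_pi. (cmod (Q x))\<^sup>2)"
  have q: "q \<ge> 0" unfolding q_def by simp
  \<comment> \<open>Chosen so that the part \<open>2 * q * \<delta> * a\<close> of the potential
    term is at most a quarter of \<open>a\<close>, less than the half of \<open>a\<close> that
    survives Young's inequality.\<close>
  define \<delta> where "\<delta> = 1 / (8 * q + 8)"
  have \<delta>: "\<delta> > 0" "2 * q * \<delta> \<le> 1/4" using q unfolding \<delta>_def by (auto simp: field_simps)
  \<comment> \<open>\<open>cmod C\<close> compensates the constant, \<open>2 * q / \<delta>\<close>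
    the other part of the potential term, and the 1 leaves one copy of \<open>b\<close>
    over.\<close>
  define \<Lambda> where "\<Lambda> = cmod C + 2 * q / \<delta> + 1"
  define lam where "lam = - complex_of_real \<Lambda>"
  have "y2 lam pi \<noteq> 0"
  proof
    assume ypi: "y2 lam pi = 0"
    define y u where "y = y2 lam" and "u = u2 lam"
    have s: "sys lam (\<lambda>_. 0) (\<lambda>_. 1) y u" unfolding y_def u_def by (rule sys_sol2)
    note c = sys_continuous[OF s]
    define y' w where "y' = (\<lambda>t. Q t * y t + u t)" and "w = (\<lambda>t. (C - lam - (Q t)\<^sup>2) * y t - Q t * u t)"
    have y': "integrable I_pi y'" "L2 y'" and w: "integrable I_pi w"
      unfolding y'_def w_def using integrable_rhs[OF c] L2_add[OF L2_continuous_mult[OF L2_Q c(1)] L2_continuous[OF c(2)]]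
      by (auto simp: mult.commute)
    have y0: "y 0 = 0" "y pi = 0" using s ypi unfolding qd_system_def y_def by auto
    have prim_y: "y x = y 0 + integral {0..x} y'" and prim_u: "u x = u 0 + integral {0..x} w" if "x \<in> {0..pi}" for x
      using s that unfolding qd_system_def y'_def w_def by auto
    have prim_cnj: "cnj (y x) = cnj (y 0) + integral {0..x} (\<lambda>t. cnj (y' t))" if "x \<in> {0..pi}" for x
      using prim_y[OF that] by (simp add: integral_cnj)
    have cy': "integrable I_pi (\<lambda>t. cnj (y' t))" using L2_integrable[OF L2_cnj[OF y'(2)]] .
    have L2y: "L2 y" using c by (intro L2_continuous)
    define a b where "a = (LINT x|I_pi. (cmod (y' x))\<^sup>2)" and "b = (LINT x|I_pi. (cmod (y x))\<^sup>2)"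
    have ab: "a \<ge> 0" "b \<ge> 0" unfolding a_def b_def by auto
    have ia: "integrable I_pi (\<lambda>x. (cmod (y' x))\<^sup>2)" and ib: "integrable I_pi (\<lambda>x. (cmod (y x))\<^sup>2)"
      using y'(2) L2y unfolding L2_def by auto
    \<comment> \<open>The derivative of \<open>u * cnj y\<close>: its integral vanishes by the
      Dirichlet conditions, and its real part is the integrand of the real part of the quadratic
      form of \<open>L - lam\<close> at \<open>y\<close>.\<close>
    define h where "h = (\<lambda>t. u t * cnj (y' t) + cnj (y t) * w t)"
    have "u pi * cnj (y pi) = u 0 * cnj (y 0) + integral {0..pi} h"
      unfolding h_def by (rule integration_by_parts_AC[OF w cy' prim_u prim_cnj]) auto
    then have h0: "integral {0..pi} h = 0" using y0 by simp
    have ih: "integrable I_pi h"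
      unfolding h_def using c cy' w
      by (intro Bochner_Integration.integrable_add integrable_continuous_mult continuous_on_cnj)
    have Reh: "(LINT x|I_pi. Re (h x)) = 0"
      using h0 ih integrable_I_pi_subinterval(4)[OF ih, of 0 pi] by simp
    \<comment> \<open>As \<open>Q^2\<close> is only integrable, controlling the integral of
      \<open>(cmod Q * cmod y)^2\<close> takes a sup bound on \<open>y\<close>. It comes from
      integrating the derivative of \<open>(cmod y)^2\<close> from 0 and splitting by Young's
      inequality.\<close>
    define S where "S = \<delta> * a + b / \<delta>"
    have ysup: "(cmod (y x))\<^sup>2 \<le> S" if x: "x \<in> {0..pi}" for x
    proof -
      let ?k = "\<lambda>t. y t * cnj (y' t) + cnj (y t) * y' t"
      have ik: "integrable I_pi ?k" 
        using c cy' y' by (intro Bochner_Integration.integrable_add integrable_continuous_mult continuous_on_cnj)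
      have "y x * cnj (y x) = y 0 * cnj (y 0) + integral {0..x} ?k"
        by (rule integration_by_parts_AC[OF y'(1) cy' prim_y prim_cnj x])
      then have "cmod (y x * cnj (y x)) = cmod (integral {0..x} ?k)"
        using y0 by simp
      then have "(cmod (y x))\<^sup>2 = cmod (integral {0..x} ?k)"
        by (simp only: norm_mult complex_mod_cnj power2_eq_square)
      also have "\<dots> \<le> (LINT t|I_pi. cmod (?k t))" by (rule norm_integral_le_L1[OF ik x])
      also have "\<dots> \<le> (LINT t|I_pi. \<delta> * (cmod (y' t))\<^sup>2 + (cmod (y t))\<^sup>2 / \<delta>)"
      proof (rule integral_mono)
        show "integrable I_pi (\<lambda>t. cmod (?k t))" using ik by simp
        show "integrable I_pi (\<lambda>t. \<delta> * (cmod (y' t))\<^sup>2 + (cmod (y t))\<^sup>2 / \<delta>)" using ia ib by simp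
        fix t
        have "cmod (?k t) \<le> 2 * cmod (y' t) * cmod (y t)"
          by (rule order_trans[OF norm_triangle_ineq]) (simp add: norm_mult)
        then show "cmod (?k t) \<le> \<delta> * (cmod (y' t))\<^sup>2 + (cmod (y t))\<^sup>2 / \<delta>"
          using Young_sq[OF \<delta>(1), of "cmod (y' t)" "cmod (y t)"] by linarith
      qed
      also have "\<dots> = S" unfolding S_def a_def b_def using ia ib by simp
      finally show ?thesis .
    qed
    have iQ: "integrable I_pi (\<lambda>x. (cmod (Q x))\<^sup>2)" using L2_Q unfolding L2_def by auto
    have "(LINT x|I_pi. (1/2) * (cmod (y' x))\<^sup>2 + (\<Lambda> - cmod C) * (cmod (y x))\<^sup>2 - 2 * S * (cmod (Q x))\<^sup>2) \<le> (LINT x|I_pi. Re (h x))"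
    proof (rule integral_mono)
      show "integrable I_pi (\<lambda>x. (1/2) * (cmod (y' x))\<^sup>2 + (\<Lambda> - cmod C) * (cmod (y x))\<^sup>2 - 2 * S * (cmod (Q x))\<^sup>2)"
        using ia ib iQ by simp
      show "integrable I_pi (\<lambda>x. Re (h x))" using ih by simp
      fix t assume "t \<in> space I_pi"
      then have t: "t \<in> {0..pi}" by simp
      have u: "u t = y' t - Q t * y t" unfolding y'_def by simp
      have cm: "z * cnj z = complex_of_real ((cmod z)\<^sup>2)" for z by (rule complex_norm_square[symmetric])
      have "h t = y' t * cnj (y' t) + (C - lam) * (y t * cnj (y t)) - Q t * (y t * cnj (y' t) + y' t * cnj (y t))"
        unfolding h_def w_def u by (simp add: algebra_simps power2_eq_square)
      then have "Re (h t) = (cmod (y' t))\<^sup>2 + Re (C - lam) * (cmod (y t))\<^sup>2 - Re (Q t * (y t * cnj (y' t) + y' t * cnj (y t)))"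
        unfolding cm by simp
      moreover have "Re (C - lam) * (cmod (y t))\<^sup>2 \<ge> (\<Lambda> - cmod C) * (cmod (y t))\<^sup>2"
        unfolding lam_def using abs_Re_le_cmod[of C] by (intro mult_right_mono) auto
      moreover have "Re (Q t * (y t * cnj (y' t) + y' t * cnj (y t))) \<le> 2 * cmod (y' t) * (cmod (Q t) * cmod (y t))"
      proof -
        have "Re (Q t * (y t * cnj (y' t) + y' t * cnj (y t))) \<le> cmod (Q t) * cmod (y t * cnj (y' t) + y' t * cnj (y t))"
          unfolding norm_mult[symmetric] by (rule complex_Re_le_cmod)
        also have "\<dots> \<le> cmod (Q t) * (cmod (y t * cnj (y' t)) + cmod (y' t * cnj (y t)))"
          by (intro mult_left_mono norm_triangle_ineq) auto
        finally show ?thesis by (simp add: norm_mult algebra_simps)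
      qed
      moreover have "2 * cmod (y' t) * (cmod (Q t) * cmod (y t)) \<le> (1/2) * (cmod (y' t))\<^sup>2 + 2 * ((cmod (Q t))\<^sup>2 * (cmod (y t))\<^sup>2)"
        using Young_sq[of "1/2" "cmod (y' t)" "cmod (Q t) * cmod (y t)"] by (simp add: power_mult_distrib)
      moreover have "2 * ((cmod (Q t))\<^sup>2 * (cmod (y t))\<^sup>2) \<le> 2 * S * (cmod (Q t))\<^sup>2"
        using mult_left_mono[OF ysup[OF t], of "(cmod (Q t))\<^sup>2"] by (simp add: mult.commute)
      ultimately show "(1/2) * (cmod (y' t))\<^sup>2 + (\<Lambda> - cmod C) * (cmod (y t))\<^sup>2 - 2 * S * (cmod (Q t))\<^sup>2 \<le> Re (h t)"
        by linarith
    qed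
    also have "(LINT x|I_pi. (1/2) * (cmod (y' x))\<^sup>2 + (\<Lambda> - cmod C) * (cmod (y x))\<^sup>2 - 2 * S * (cmod (Q x))\<^sup>2) =
      (1/2) * a + (\<Lambda> - cmod C) * b - 2 * S * q"
      unfolding a_def b_def q_def using ia ib iQ by simp
    finally have "(1/2) * a + (\<Lambda> - cmod C) * b \<le> 2 * S * q" unfolding Reh by simp
    moreover have "2 * S * q = (2 * q * \<delta>) * a + (2 * q / \<delta>) * b" unfolding S_def by (simp add: algebra_simps)
    moreover have "(2 * q * \<delta>) * a \<le> (1/4) * a" using \<delta> ab by (intro mult_right_mono) auto
    moreover have "(\<Lambda> - cmod C) * b = (2 * q / \<delta>) * b + b" unfolding \<Lambda>_def by (simp add: algebra_simps)
    \<comment> \<open>What is left after the cancellations is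
      \<open>a / 4 + b \<le> 0\<close>.\<close>
    ultimately have "b = 0" using ab by linarith
    then have "H0_norm y = 0" unfolding H0_norm_def b_def by simp
    then show False using H0_norm_eq_0_iff[OF L2y] y2_not_zero unfolding y_def by blast
  qed
  then show ?thesis by blast
qed

section \<open>Dependence on the spectral parameter\<close>

text \<open>The Taylor coefficients of \<open>(y2, u2)\<close> in the spectral parameter.\<close>
primrec root_chain :: "complex \<Rightarrow> nat \<Rightarrow> (real \<Rightarrow> complex) \<times> (real \<Rightarrow> complex)" where
  "root_chain lam 0 = sol2 lam"
| "root_chain lam (Suc j) =
     (SOME p. sys lam (\<lambda>_. 0) (\<lambda>x. - integral {0..x} (fst (root_chain lam j))) (fst p) (snd p))"

text \<open>The choice made in \<open>root_chain\<close> yields a solution once the preceding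
  function is integrable, so continuity has to be carried along the recursion.\<close>

lemma
  shows chain_continuous: "continuous_on {0..pi} (fst (root_chain lam j))"
    and sys_chain_Suc: "sys lam (\<lambda>_. 0) (\<lambda>x. - integral {0..x} (fst (root_chain lam j))) (fst (root_chain lam (Suc j))) (snd (root_chain lam (Suc j)))"
proof -
  have step: "sys lam (\<lambda>_. 0) (\<lambda>x. - integral {0..x} (fst (root_chain lam j))) (fst (root_chain lam (Suc j))) (snd (root_chain lam (Suc j)))"
    if c: "continuous_on {0..pi} (fst (root_chain lam j))" for j
  proof -
    obtain y u where "sys lam (\<lambda>_. 0) (\<lambda>x. - integral {0..x} (fst (root_chain lam j))) y u"
      using sys_exists[OF continuous_on_const continuous_on_minus[OF continuous_on_integral_I_pi[OF integrable_continuous_I_pi[OF c]]]] by blast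
    then have "sys lam (\<lambda>_. 0) (\<lambda>x. - integral {0..x} (fst (root_chain lam j))) (fst (y, u)) (snd (y, u))" by simp
    then show ?thesis unfolding root_chain.simps by (rule someI)
  qed
  show c: "continuous_on {0..pi} (fst (root_chain lam j))" for j
  proof (induction j)
    case 0 then show ?case using sys_continuous(1)[OF sys_sol2] by simp
  next
    case (Suc j) then show ?case using sys_continuous(1)[OF step] by blast
  qed
  show "sys lam (\<lambda>_. 0) (\<lambda>x. - integral {0..x} (fst (root_chain lam j))) (fst (root_chain lam (Suc j))) (snd (root_chain lam (Suc j)))"
    using step c by blast
qed

lemma norm_integral_continuous_le:
  fixes y :: "real \<Rightarrow> complex"
  assumes "continuous_on {0..pi} y" "\<And>x. x \<in> {0..pi} \<Longrightarrow> cmod (y x) \<le> B" "x \<in> {0..pi}"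
  shows "cmod (integral {0..x} y) \<le> pi * B"
proof -
  have "0 \<le> B" using assms(2,3) by (meson norm_ge_zero order_trans)
  have "cmod (integral {0..x} y) \<le> integral {0..x} (\<lambda>_. B)"
    using assms by (intro norm_integral_le_integral integrable_continuous_I_pi) auto
  also have "\<dots> \<le> pi * B" using assms(3) \<open>0 \<le> B\<close> by (simp add: mult_right_mono)
  finally show ?thesis .
qed

text \<open>Each step of the recursion costs a factor \<open>sys_const lam * pi\<close>; its inverse
  is the radius of the discs used below.\<close>

lemma chain_bound:
  assumes "x \<in> {0..pi}"
  shows "cmod (fst (root_chain lam j) x) \<le> sys_const lam * (sys_const lam * pi) ^ j"
  using assms
proof (induction j arbitrary: x)
  case 0
  then show ?case using sys_bound(1)[OF sys_sol2, of 1 x lam] by simp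
next
  case (Suc j)
  have "cmod (fst (root_chain lam (Suc j)) x) \<le> sys_const lam * (pi * (sys_const lam * (sys_const lam * pi) ^ j))"
  proof (rule sys_bound(1)[OF sys_chain_Suc _ _ Suc.prems])
    fix t assume "t \<in> {0..pi}"
    then show "cmod (- integral {0..t} (fst (root_chain lam j))) \<le> pi * (sys_const lam * (sys_const lam * pi) ^ j)"
      using norm_integral_continuous_le[OF chain_continuous Suc.IH, where x = t] by simp
  qed (use sys_const_pos[of lam] in simp)
  then show ?case by (simp add: mult_ac)
qed

text \<open>The Taylor polynomial solves the system at \<open>mu\<close> up to one forcing term:
  when the next term is shifted from \<open>lam\<close> to \<open>mu\<close>, its own forcing
  cancels the old remainder and the shift creates the new one.\<close>

lemma sys_chain_partial_sum:
  "sys mu (\<lambda>_. 0) (\<lambda>x. 1 + (mu - lam) ^ Suc n * integral {0..x} (fst (root_chain lam n)))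
     (\<lambda>x. \<Sum>j\<le>n. (mu - lam) ^ j * fst (root_chain lam j) x) (\<lambda>x. \<Sum>j\<le>n. (mu - lam) ^ j * snd (root_chain lam j) x)"
proof (induction n)
  case 0
  show ?case using sys_shift[OF sys_sol2[of lam], where mu = mu]
    by (rule_tac sys_cong) (auto simp: algebra_simps)
next
  case (Suc n)
  show ?case
    using sys_add_scaled[OF Suc sys_shift[OF sys_chain_Suc[of lam n], where mu = mu], of "(mu - lam) ^ Suc n"]
    by (rule_tac sys_cong) (auto simp: algebra_simps)
qed

text \<open>The a priori bound at \<open>mu\<close> turns the forcing remainder into a geometric
  error. Its constant may depend on \<open>mu\<close>, because convergence at each point of a disc
  fixed by \<open>lam\<close> is enough.\<close>

lemma y2_power_series:
  assumes mu: "cmod (mu - lam) * (sys_const lam * pi) < 1"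
  shows "(\<lambda>j. fst (root_chain lam j) pi * (mu - lam) ^ j) sums y2 mu pi"
proof -
  define K \<rho> where "K = sys_const lam" and "\<rho> = cmod (mu - lam) * (sys_const lam * pi)"
  have K: "K > 0" "sys_const mu > 0" unfolding K_def by (rule sys_const_pos)+
  have bound: "cmod ((\<Sum>j\<le>n. (mu - lam) ^ j * fst (root_chain lam j) pi) - y2 mu pi) \<le> sys_const mu * \<rho> ^ Suc n" for n
  proof -
    have "sys mu (\<lambda>_. 0) (\<lambda>x. (mu - lam) ^ Suc n * integral {0..x} (fst (root_chain lam n)))
     (\<lambda>x. (\<Sum>j\<le>n. (mu - lam) ^ j * fst (root_chain lam j) x) + (-1) * y2 mu x) (\<lambda>x. (\<Sum>j\<le>n. (mu - lam) ^ j * snd (root_chain lam j) x) + (-1) * u2 mu x)"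
      by (rule sys_cong[OF sys_add_scaled[OF sys_chain_partial_sum sys_sol2]]) auto
    then have "cmod ((\<Sum>j\<le>n. (mu - lam) ^ j * fst (root_chain lam j) pi) + (-1) * y2 mu pi) \<le> sys_const mu * \<rho> ^ Suc n"
    proof (rule sys_bound(1))
      fix x assume x: "x \<in> {0..pi}"
      have "cmod (integral {0..x} (fst (root_chain lam n))) \<le> pi * (K * (K * pi) ^ n)"
        unfolding K_def by (rule norm_integral_continuous_le[OF chain_continuous chain_bound x])
      then have "cmod ((mu - lam) ^ Suc n * integral {0..x} (fst (root_chain lam n))) \<le> cmod (mu - lam) ^ Suc n * (pi * (K * (K * pi) ^ n))"
        unfolding norm_mult norm_power by (intro mult_left_mono) auto
      also have "\<dots> = \<rho> ^ Suc n" unfolding \<rho>_def K_def by (simp add: power_mult_distrib mult_ac)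
      finally show "cmod ((mu - lam) ^ Suc n * integral {0..x} (fst (root_chain lam n))) \<le> \<rho> ^ Suc n" .
    qed (use K in \<open>auto simp: \<rho>_def K_def\<close>)
    then show ?thesis by simp
  qed
  have "(\<lambda>n. sys_const mu * \<rho> ^ Suc n) \<longlonglongrightarrow> sys_const mu * 0"
    using mu K unfolding \<rho>_def K_def by (intro tendsto_mult tendsto_const LIMSEQ_Suc LIMSEQ_realpow_zero) auto
  then have "(\<lambda>n. (\<Sum>j\<le>n. (mu - lam) ^ j * fst (root_chain lam j) pi) - y2 mu pi) \<longlonglongrightarrow> 0"
    by (intro Lim_null_comparison[OF always_eventually[OF allI[OF bound]]]) simp
  then have "(\<lambda>n. \<Sum>j\<le>n. (mu - lam) ^ j * fst (root_chain lam j) pi) \<longlonglongrightarrow> y2 mu pi"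
    by (rule LIM_zero_cancel)
  then show ?thesis unfolding sums_def_le by (simp add: mult.commute)
qed

lemma y2_holomorphic: "(\<lambda>lam. y2 lam pi) holomorphic_on UNIV"
proof -
  have "(\<lambda>lam. y2 lam pi) holomorphic_on ball lam (1 / (sys_const lam * pi))" for lam
  proof (rule power_series_holomorphic)
    fix mu assume "mu \<in> ball lam (1 / (sys_const lam * pi))"
    then have "cmod (mu - lam) * (sys_const lam * pi) < 1"
      using sys_const_pos[of lam] by (simp add: dist_norm norm_minus_commute field_simps)
    then show "(\<lambda>j. fst (root_chain lam j) pi * (mu - lam) ^ j) sums y2 mu pi" by (rule y2_power_series)
  qed
  then have "(\<lambda>lam. y2 lam pi) field_differentiable at lam" for lam
    using sys_const_pos[of lam] by (intro holomorphic_on_imp_differentiable_at[of _ "ball lam (1 / (sys_const lam * pi))"]) auto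
  then show ?thesis by (simp add: holomorphic_on_def field_differentiable_at_within)
qed

lemma zeros_discrete: "\<not> z islimpt {lam. y2 lam pi = 0}"
proof
  assume "z islimpt {lam. y2 lam pi = 0}"
  from analytic_continuation[OF y2_holomorphic open_UNIV connected_UNIV subset_UNIV UNIV_I this]
  have "y2 lam pi = 0" for lam by blast
  then show False using y2_pi_nonzero_exists by blast
qed

text \<open>Otherwise the series around \<open>lam\<close> would vanish on a disc, making
  \<open>lam\<close> a limit point of zeros. The least such \<open>j\<close> is the order of
  vanishing at \<open>lam\<close>.\<close>

lemma chain_end_nonzero: "\<exists>j. fst (root_chain lam j) pi \<noteq> 0"
proof (rule ccontr)
  assume "\<not> ?thesis"
  then have 0: "fst (root_chain lam j) pi = 0" for j by blast
  have "y2 mu pi = 0" if "mu \<in> ball lam (1 / (sys_const lam * pi))" for mu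
  proof -
    have "cmod (mu - lam) * (sys_const lam * pi) < 1"
      using that sys_const_pos[of lam] by (simp add: dist_norm norm_minus_commute field_simps)
    from y2_power_series[OF this] have "(\<lambda>j. 0) sums y2 mu pi" unfolding 0 by simp
    then show ?thesis using sums_unique2[OF _ sums_zero] by blast
  qed
  then have "ball lam (1 / (sys_const lam * pi)) \<subseteq> {mu. y2 mu pi = 0}" by blast
  moreover have "lam islimpt ball lam (1 / (sys_const lam * pi))"
    using sys_const_pos[of lam] by (simp add: islimpt_ball)
  ultimately show False using zeros_discrete islimpt_subset by blast
qed


section \<open>Root vectors\<close>

text \<open>Apart from the condition at \<open>pi\<close>, \<open>L - lam\<close> lowers the chain
  index by one and annihilates \<open>y2\<close>. A preimage of a combination is thus the
  combination with raised indices, and \<open>d * y2\<close> accounts for the free value of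
  \<open>u\<close> at 0.\<close>

lemma sys_chain_combination:
  "\<exists>v. sys lam (\<lambda>_. 0) (\<lambda>x. d - (\<Sum>i<n. c i * integral {0..x} (fst (root_chain lam i))))
     (\<lambda>x. d * y2 lam x + (\<Sum>i<n. c i * fst (root_chain lam (Suc i)) x)) v"
proof (induction n)
  case 0
  have "sys lam (\<lambda>_. 0) (\<lambda>_. 0) (\<lambda>_. 0) (\<lambda>_. 0)" unfolding qd_system_def by simp
  from sys_add_scaled[OF this sys_sol2, of d] show ?case by auto
next
  case (Suc n)
  then obtain v where "sys lam (\<lambda>_. 0) (\<lambda>x. d - (\<Sum>i<n. c i * integral {0..x} (fst (root_chain lam i))))
     (\<lambda>x. d * y2 lam x + (\<Sum>i<n. c i * fst (root_chain lam (Suc i)) x)) v" by blast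
  from sys_add_scaled[OF this sys_chain_Suc[of lam n], of "c n"] show ?case
    by (intro exI) (auto simp: algebra_simps simp del: root_chain.simps elim!: sys_cong)
qed

text \<open>A preimage of an element of the span of indices up to \<open>M\<close> lies in the span
  of indices up to \<open>Suc M\<close>. Only the last function is nonzero at \<open>pi\<close>, so
  the Dirichlet condition there removes it and the smaller span is closed under taking
  preimages.\<close>

lemma root_vector_step:
  assumes zero: "\<And>j. j < Suc M \<Longrightarrow> fst (root_chain lam j) pi = 0" and nz: "fst (root_chain lam (Suc M)) pi \<noteq> 0"
    and y: "LDir Q C y (\<lambda>x. h x + lam * y x)" and h: "ae_eq h (\<lambda>x. \<Sum>i<Suc M. c i * fst (root_chain lam i) x)"
  shows "\<exists>c'. \<forall>x\<in>{0..pi}. y x = (\<Sum>i<Suc M. c' i * fst (root_chain lam i) x)"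
proof -
  define g where "g = (\<lambda>x. \<Sum>i<Suc M. c i * fst (root_chain lam i) x)"
  have g: "continuous_on {0..pi} g" unfolding g_def
    by (intro continuous_on_sum continuous_on_mult continuous_on_const chain_continuous)
  have "LDir Q C y (\<lambda>x. g x + lam * y x)"
    using y by (rule LDir_cong_AE) (use h in \<open>auto simp: ae_eq_def g_def elim: eventually_mono\<close>)
  then obtain d u where s: "sys lam (\<lambda>_. 0) (\<lambda>x. d - integral {0..x} g) y u" "y pi = 0"
    using LDir_imp_sys[OF _ L2_continuous[OF g]] by blast
  obtain v where "sys lam (\<lambda>_. 0) (\<lambda>x. d - (\<Sum>i<Suc M. c i * integral {0..x} (fst (root_chain lam i))))
     (\<lambda>x. d * y2 lam x + (\<Sum>i<Suc M. c i * fst (root_chain lam (Suc i)) x)) v"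
    using sys_chain_combination by blast
  then have s': "sys lam (\<lambda>_. 0) (\<lambda>x. d - integral {0..x} g) (\<lambda>x. d * y2 lam x + (\<Sum>i<Suc M. c i * fst (root_chain lam (Suc i)) x)) v"
  proof (rule sys_cong)
    fix x assume x: "x \<in> {0..pi}"
    have "integral {0..x} g = (\<Sum>i<Suc M. integral {0..x} (\<lambda>x. c i * fst (root_chain lam i) x))"
      unfolding g_def using x
      by (intro integral_sum integrable_I_pi_subinterval(2) integrable_continuous_I_pi continuous_on_mult continuous_on_const chain_continuous) auto
    then show "d - (\<Sum>i<Suc M. c i * integral {0..x} (fst (root_chain lam i))) = d - integral {0..x} g" by simp
  qed simp
  have yeq: "y x = d * y2 lam x + (\<Sum>i<Suc M. c i * fst (root_chain lam (Suc i)) x)" if "x \<in> {0..pi}" for x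
    using sys_unique(1)[OF s(1) s' that] .
  have "(\<Sum>i<M. c i * fst (root_chain lam (Suc i)) pi) = 0"
    using zero by (intro sum.neutral) (auto simp del: root_chain.simps)
  moreover have "y2 lam pi = 0" using zero[of 0] by simp
  ultimately have "c M * fst (root_chain lam (Suc M)) pi = 0" using yeq[of pi] s(2) by (simp del: root_chain.simps)
  then have "c M = 0" using nz by simp
  \<comment> \<open>The coefficients move up by one place, and \<open>d\<close> takes place
    0.\<close>
  then have "y x = (\<Sum>i<Suc M. (case i of 0 \<Rightarrow> d | Suc k \<Rightarrow> c k) * fst (root_chain lam i) x)" if "x \<in> {0..pi}" for x
    using yeq[OF that] by (subst sum.lessThan_Suc_shift) (simp del: root_chain.simps(2))
  then show ?thesis by blast
qed

lemma finite_alg_mult_of_zero: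
  assumes "y2 lam pi = 0"
  shows "finite_alg_mult Q C lam"
proof -
  define N where "N = (LEAST j. fst (root_chain lam j) pi \<noteq> 0)"
  have nz: "fst (root_chain lam N) pi \<noteq> 0" unfolding N_def using chain_end_nonzero by (rule LeastI_ex)
  have zero: "fst (root_chain lam j) pi = 0" if "j < N" for j using that not_less_Least unfolding N_def by blast
  have "N \<noteq> 0" using nz assms by (cases N) auto
  then obtain M where M: "N = Suc M" using not0_implies_Suc by blast
  define bs where "bs = map (\<lambda>j. fst (root_chain lam j)) [0..<N]"
  have bs: "(\<Sum>i<length bs. c i * (bs ! i) x) = (\<Sum>i<N. c i * fst (root_chain lam i) x)" for c x
    unfolding bs_def by (intro sum.cong) auto
  show ?thesis unfolding finite_alg_mult_def
  proof (intro exI[of _ bs] allI impI)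
    fix y assume "root_vector Q C lam y"
    then obtain k ys where ys: "ys 0 = y" "\<And>j. j < k \<Longrightarrow> LDir Q C (ys j) (\<lambda>x. ys (Suc j) x + lam * ys j x)"
      and k: "ae_eq (ys k) (\<lambda>x. 0)" unfolding root_vector_def by blast
    have "\<exists>c. ae_eq (ys 0) (\<lambda>x. \<Sum>i<N. c i * fst (root_chain lam i) x)"
    \<comment> \<open>Backwards along the Jordan chain from \<open>ys k\<close>, which vanishes
      almost everywhere: membership in the span passes from \<open>ys (Suc j)\<close> to its
      preimage \<open>ys j\<close>.\<close>
    proof (rule inc_induct[of 0 k])
      show "\<exists>c. ae_eq (ys k) (\<lambda>x. \<Sum>i<N. c i * fst (root_chain lam i) x)"
        using k by (intro exI[of _ "\<lambda>_. 0"]) simp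
      fix j assume "j < k" and "\<exists>c. ae_eq (ys (Suc j)) (\<lambda>x. \<Sum>i<N. c i * fst (root_chain lam i) x)"
      then obtain c' where "\<forall>x\<in>{0..pi}. ys j x = (\<Sum>i<N. c' i * fst (root_chain lam i) x)"
        using root_vector_step[OF _ _ ys(2)] zero nz unfolding M by blast
      then show "\<exists>c. ae_eq (ys j) (\<lambda>x. \<Sum>i<N. c i * fst (root_chain lam i) x)"
        unfolding ae_eq_def by (intro exI[of _ c'] AE_I2) simp
    qed simp
    then show "\<exists>c. ae_eq y (\<lambda>x. \<Sum>i<length bs. c i * (bs ! i) x)" unfolding bs ys(1) .
  qed
qed

lemma discrete_spectrum_LDir: "discrete_spectrum Q C"
  unfolding discrete_spectrum_def spectrum_eq y2_pi_eq
  using zeros_discrete eigenvalue_of_zero finite_alg_mult_of_zero by blast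

section \<open>Closedness\<close>

text \<open>Let \<open>y1\<close> solve \<open>(L - lam) y1 = f - lam y\<close>. Then
  \<open>y1 - ys n\<close> solves the resolvent equation with right-hand side
  \<open>(f - fs n) - lam (y - ys n)\<close>, which tends to 0, so \<open>y1\<close> agrees with
  \<open>y\<close> almost everywhere.\<close>

lemma closed_op_LDir: "closed_op Q C"
  unfolding closed_op_def
proof (intro allI impI, elim conjE)
  fix ys fs y f
  assume ys: "\<forall>n. LDir Q C (ys n) (fs n)" and y: "L2 y" and f: "L2 f"
    and ylim: "(\<lambda>n. H0_norm (\<lambda>x. ys n x - y x)) \<longlonglongrightarrow> 0"
    and flim: "(\<lambda>n. H0_norm (\<lambda>x. fs n x - f x)) \<longlonglongrightarrow> 0"
  obtain lam where lam: "y2 lam pi \<noteq> 0" using y2_pi_nonzero_exists by blast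
  define g where "g = (\<lambda>x. f x - lam * y x)"
  have g: "L2 g" unfolding g_def using f y by (intro L2_diff L2_cmult)
  obtain y1 where y1: "LDir Q C y1 (\<lambda>x. g x + lam * y1 x)" using LDir_solvable[OF lam g] .
  have L2y1: "L2 y1" using LDir_continuous[OF y1] by (rule L2_continuous)
  define M where "M = bvp_const lam * pi"
  \<comment> \<open>Two uses of \<open>H0_norm_add_sq_le\<close>: one for
    \<open>y1 - y = d + (ys n - y)\<close>, one for the right-hand side belonging to
    \<open>d\<close>.\<close>
  define \<epsilon> where "\<epsilon> = (\<lambda>n. 2 * (M\<^sup>2 * (2 * (H0_norm (\<lambda>x. fs n x - f x))\<^sup>2 + 2 * (cmod lam * H0_norm (\<lambda>x. ys n x - y x))\<^sup>2)) + 2 * (H0_norm (\<lambda>x. ys n x - y x))\<^sup>2)"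
  have bound: "(H0_norm (\<lambda>x. y1 x - y x))\<^sup>2 \<le> \<epsilon> n" for n
  proof -
    define h where "h = (\<lambda>x. (fs n x - f x) + (- lam) * (ys n x - y x))"
    define d where "d = (\<lambda>x. y1 x + (-1) * ys n x)"
    have n: "L2 (fs n)" "L2 (ys n)"
      using LDir_L2 L2_continuous[OF LDir_continuous] ys by blast+
    have L2s: "L2 (\<lambda>x. fs n x - f x)" "L2 (\<lambda>x. ys n x - y x)" "L2 d"
      unfolding d_def by (rule L2_diff[OF n(1) f], rule L2_diff[OF n(2) y], rule L2_add[OF L2y1 L2_cmult[OF n(2)]])
    have h: "L2 h" unfolding h_def by (intro L2_add L2_cmult L2s)
    have "LDir Q C d (\<lambda>x. (g x + lam * y1 x) + (-1) * fs n x)"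
      unfolding d_def by (rule LDir_add_scaled[OF y1]) (use ys in blast)
    also have "(\<lambda>x. (g x + lam * y1 x) + (-1) * fs n x) = (\<lambda>x. (-1) * h x + lam * d x)"
      unfolding h_def d_def g_def by (auto simp: algebra_simps)
    finally have "H0_norm d \<le> M * H0_norm (\<lambda>x. (-1) * h x)"
      unfolding M_def by (rule LDir_norm_bound[OF lam L2_cmult[OF h]])
    then have "H0_norm d \<le> M * H0_norm h" unfolding H0_norm_cmult by simp
    then have "(H0_norm d)\<^sup>2 \<le> M\<^sup>2 * (H0_norm h)\<^sup>2"
      unfolding power_mult_distrib[symmetric] by (intro power_mono H0_norm_nonneg)
    also have "\<dots> \<le> M\<^sup>2 * (2 * (H0_norm (\<lambda>x. fs n x - f x))\<^sup>2 + 2 * (cmod lam * H0_norm (\<lambda>x. ys n x - y x))\<^sup>2)"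
      using H0_norm_add_sq_le[OF L2s(1) L2_cmult[OF L2s(2), of "- lam"]]
      unfolding h_def[symmetric] H0_norm_cmult by (intro mult_left_mono) auto
    finally have "(H0_norm d)\<^sup>2 \<le> \<dots>" .
    moreover have "(\<lambda>x. y1 x - y x) = (\<lambda>x. d x + (ys n x - y x))" unfolding d_def by (auto simp: algebra_simps)
    ultimately show ?thesis using H0_norm_add_sq_le[OF L2s(3,2)] unfolding \<epsilon>_def by simp
  qed
  have "\<epsilon> \<longlonglongrightarrow> 2 * (M\<^sup>2 * (2 * 0\<^sup>2 + 2 * (cmod lam * 0)\<^sup>2)) + 2 * 0\<^sup>2"
    unfolding \<epsilon>_def by (intro tendsto_intros ylim flim)
  then have "\<epsilon> \<longlonglongrightarrow> 0" by simp
  then have "(H0_norm (\<lambda>x. y1 x - y x))\<^sup>2 \<le> 0"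
    by (rule LIMSEQ_le_const) (use bound in blast)
  then have ae: "ae_eq (\<lambda>x. y1 x - y x) (\<lambda>_. 0)"
    using H0_norm_eq_0_iff[OF L2_diff[OF L2y1 y]] by simp
  have "LDir Q C y1 f"
    using y1 by (rule LDir_cong_AE) (use ae in \<open>auto simp: ae_eq_def g_def elim: eventually_mono\<close>)
  then show "\<exists>y1. ae_eq y1 y \<and> LDir Q C y1 f"
    using ae by (intro exI[of _ y1]) (auto simp: ae_eq_def)
qed

end

section \<open>The adjoint\<close>

lemma qd_system_cnj:
  assumes "qd_system Q C lam a b y u"
  shows "qd_system (\<lambda>x. cnj (Q x)) (cnj C) (cnj lam) (\<lambda>x. cnj (a x)) (\<lambda>x. cnj (b x)) (\<lambda>x. cnj (y x)) (\<lambda>x. cnj (u x))"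
  using assms unfolding qd_system_def
  by (auto simp: integral_cnj intro!: continuous_on_cnj)

lemma H0_inner_linear_left:
  assumes "L2 f" "L2 f'" "L2 g"
  shows "H0_inner (\<lambda>x. f x + k * f' x) g = H0_inner f g + k * H0_inner f' g"
proof -
  have "(LINT x|I_pi. (f x + k * f' x) * cnj (g x)) = (LINT x|I_pi. f x * cnj (g x) + k * (f' x * cnj (g x)))"
    by (simp add: algebra_simps)
  also have "\<dots> = (LINT x|I_pi. f x * cnj (g x)) + k * (LINT x|I_pi. f' x * cnj (g x))"
    using L2_mult_integrable[OF assms(1) L2_cnj[OF assms(3)]] L2_mult_integrable[OF assms(2) L2_cnj[OF assms(3)]]
    by (subst Bochner_Integration.integral_add) auto
  finally show ?thesis unfolding H0_inner_def by (simp add: add_divide_distrib)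
qed

lemma H0_inner_commute: "H0_inner g f = cnj (H0_inner f g)"
  unfolding H0_inner_def by (simp flip: Bochner_Integration.integral_cnj add: mult.commute)

lemma H0_inner_linear_right:
  assumes "L2 f" "L2 f'" "L2 g"
  shows "H0_inner g (\<lambda>x. f x + k * f' x) = H0_inner g f + cnj k * H0_inner g f'"
  using H0_inner_linear_left[OF assms, of k] by (subst (1 2 3) H0_inner_commute) simp

lemma H0_inner_self:
  assumes "L2 f"
  shows "H0_inner f f = complex_of_real ((H0_norm f)\<^sup>2)"
proof -
  have "(LINT x|I_pi. f x * cnj (f x)) = (LINT x|I_pi. complex_of_real ((cmod (f x))\<^sup>2))"
    by (simp only: complex_norm_square)
  then have "(LINT x|I_pi. f x * cnj (f x)) = complex_of_real (LINT x|I_pi. (cmod (f x))\<^sup>2)"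
    by (simp only: integral_complex_of_real)
  then show ?thesis unfolding H0_inner_def H0_norm_def by simp
qed

lemma H0_inner_cong_AE:
  assumes "L2 f" "L2 g" "ae_eq g1 g"
  shows "H0_inner f g1 = H0_inner f g"
proof -
  have "(LINT x|I_pi. f x * cnj (g1 x)) = (LINT x|I_pi. f x * cnj (g x))"
  proof (rule integral_cong_AE)
    show "(\<lambda>x. f x * cnj (g1 x)) \<in> borel_measurable I_pi" "(\<lambda>x. f x * cnj (g x)) \<in> borel_measurable I_pi"
      using L2_mult_integrable[OF assms(1) L2_cnj[OF L2_cong_AE[OF assms(2,3)]]]
        L2_mult_integrable[OF assms(1) L2_cnj[OF assms(2)]] by (simp_all add: borel_measurable_integrable)
    show "AE x in I_pi. f x * cnj (g1 x) = f x * cnj (g x)"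
      using assms(3) unfolding ae_eq_def by (rule eventually_mono) simp
  qed
  then show ?thesis unfolding H0_inner_def by simp
qed

context L2_potential
begin

text \<open>Moves \<open>f\<close> from the forcing into the integrand, the form that integration by
  parts expects.\<close>

lemma sys_primitive:
  assumes s: "sys lam (\<lambda>_. 0) (\<lambda>x. c - integral {0..x} f) y u" and f: "integrable I_pi f" and x: "x \<in> {0..pi}"
  shows "y x = y 0 + integral {0..x} (\<lambda>t. Q t * y t + u t)"
    and "u x = u 0 + integral {0..x} (\<lambda>t. (C - lam - (Q t)\<^sup>2) * y t - Q t * u t - f t)"
proof -
  have "integral {0..x} (\<lambda>t. ((C - lam - (Q t)\<^sup>2) * y t - Q t * u t) - f t) =
      integral {0..x} (\<lambda>t. (C - lam - (Q t)\<^sup>2) * y t - Q t * u t) - integral {0..x} f"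
    using x f sys_continuous[OF s]
    by (intro Henstock_Kurzweil_Integration.integral_diff) (auto intro!: integrable_I_pi_subinterval(2) integrable_rhs)
  moreover have "u 0 = c" using s unfolding qd_system_def by auto
  ultimately show "u x = u 0 + integral {0..x} (\<lambda>t. (C - lam - (Q t)\<^sup>2) * y t - Q t * u t - f t)"
    using s x unfolding qd_system_def by auto
  have "y 0 = 0" using s unfolding qd_system_def by auto
  then show "y x = y 0 + integral {0..x} (\<lambda>t. Q t * y t + u t)"
    using s x unfolding qd_system_def by auto
qed

lemma conjugate_potential: "L2_potential (\<lambda>x. cnj (Q x))"
  by unfold_locales (rule L2_cnj[OF L2_Q])

text \<open>The quasi-Wronskian \<open>u G - y V\<close> has derivative \<open>y H - f G\<close>.\<close>
lemma Lagrange_identity: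
  assumes y: "LDir Q C y f" and g: "LDir (\<lambda>x. cnj (Q x)) (cnj C) g h"
  shows "H0_inner f g = H0_inner y h"
proof -
  interpret star: L2_potential "\<lambda>x. cnj (Q x)" "cnj C" by (rule conjugate_potential)
  have fh: "L2 f" "L2 h" using LDir_L2[OF y] star.LDir_L2[OF g] .
  have "LDir Q C y (\<lambda>x. f x + 0 * y x)" using y by simp
  then obtain c u where s1: "sys 0 (\<lambda>_. 0) (\<lambda>x. c - integral {0..x} f) y u" and y0: "y 0 = 0" "y pi = 0"
    using LDir_imp_sys fh(1) by blast
  have "LDir (\<lambda>x. cnj (Q x)) (cnj C) g (\<lambda>x. h x + 0 * g x)" using g by simp
  then obtain d v where s2: "star.sys 0 (\<lambda>_. 0) (\<lambda>x. d - integral {0..x} h) g v" and g0: "g 0 = 0" "g pi = 0"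
    using star.LDir_imp_sys fh(2) by blast
  \<comment> \<open>Conjugation returns to the system with the original \<open>Q\<close> and
    \<open>C\<close>, so the computation is bilinear from here on.\<close>
  define G V H where "G = (\<lambda>x. cnj (g x))" and "V = (\<lambda>x. cnj (v x))" and "H = (\<lambda>x. cnj (h x))"
  have s2': "sys 0 (\<lambda>_. 0) (\<lambda>x. cnj d - integral {0..x} H) G V"
    using qd_system_cnj[OF s2] unfolding G_def V_def H_def by (simp add: integral_cnj)
  have G0: "G 0 = 0" "G pi = 0" using g0 unfolding G_def by auto
  have H: "L2 H" using L2_cnj[OF fh(2)] unfolding H_def .
  note ifh = L2_integrable[OF fh(1)] L2_integrable[OF H]
  note c1 = sys_continuous[OF s1] and c2 = sys_continuous[OF s2']
  let ?y' = "\<lambda>t. Q t * y t + u t" and ?G' = "\<lambda>t. Q t * G t + V t"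
  let ?u' = "\<lambda>t. (C - 0 - (Q t)\<^sup>2) * y t - Q t * u t - f t" and ?V' = "\<lambda>t. (C - 0 - (Q t)\<^sup>2) * G t - Q t * V t - H t"
  have i: "integrable I_pi ?y'" "integrable I_pi ?G'" "integrable I_pi ?u'" "integrable I_pi ?V'"
    by (rule integrable_rhs[OF c1], rule integrable_rhs[OF c2],
        rule Bochner_Integration.integrable_diff[OF integrable_rhs(2)[OF c1] ifh(1)],
        rule Bochner_Integration.integrable_diff[OF integrable_rhs(2)[OF c2] ifh(2)])
  have p1: "u pi * G pi = u 0 * G 0 + integral {0..pi} (\<lambda>t. u t * ?G' t + G t * ?u' t)"
    by (rule integration_by_parts_AC[OF i(3,2) sys_primitive(2)[OF s1 ifh(1)] sys_primitive(1)[OF s2' ifh(2)]]) auto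
  have p2: "y pi * V pi = y 0 * V 0 + integral {0..pi} (\<lambda>t. y t * ?V' t + V t * ?y' t)"
    by (rule integration_by_parts_AC[OF i(1,4) sys_primitive(1)[OF s1 ifh(1)] sys_primitive(2)[OF s2' ifh(2)]]) auto
  have int: "integrable I_pi (\<lambda>t. u t * ?G' t + G t * ?u' t)" "integrable I_pi (\<lambda>t. y t * ?V' t + V t * ?y' t)"
    using i c1 c2 by (auto intro!: Bochner_Integration.integrable_add integrable_continuous_mult)
  have int': "integrable I_pi (\<lambda>t. y t * H t)" "integrable I_pi (\<lambda>t. f t * G t)"
    using c1 c2 fh H by (auto intro!: L2_mult_integrable L2_continuous)
  have "integral {0..pi} (\<lambda>t. y t * H t) - integral {0..pi} (\<lambda>t. f t * G t) = integral {0..pi} (\<lambda>t. y t * H t - f t * G t)"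
    using int' by (intro Henstock_Kurzweil_Integration.integral_diff[symmetric]) (auto intro: integrable_I_pi_subinterval(2))
  \<comment> \<open>The terms with \<open>Q\<close>, \<open>Q^2\<close>, \<open>C\<close> and
    \<open>u * V\<close> cancel pointwise.\<close>
  also have "\<dots> = integral {0..pi} (\<lambda>t. (u t * ?G' t + G t * ?u' t) - (y t * ?V' t + V t * ?y' t))"
    by (intro arg_cong[where f="integral _"] ext) (simp add: algebra_simps)
  also have "\<dots> = integral {0..pi} (\<lambda>t. u t * ?G' t + G t * ?u' t) - integral {0..pi} (\<lambda>t. y t * ?V' t + V t * ?y' t)"
    by (intro Henstock_Kurzweil_Integration.integral_diff integrable_I_pi_subinterval(2) int) auto
  also have "\<dots> = 0" using p1 p2 y0 G0 by simp
  finally have "(LINT t|I_pi. f t * G t) = (LINT t|I_pi. y t * H t)"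
    using integrable_I_pi_subinterval(4)[OF int'(1), of 0 pi] integrable_I_pi_subinterval(4)[OF int'(2), of 0 pi] by simp
  then show ?thesis unfolding H0_inner_def G_def H_def by simp
qed

text \<open>For the forward direction, solve the conjugate resolvent equation at
  \<open>cnj lam\<close> with right-hand side \<open>h - cnj lam * g\<close>. The difference
  \<open>d\<close> of this solution and \<open>g\<close> is orthogonal to the range of
  \<open>L - lam\<close>, which is all of \<open>H^0\<close>, so \<open>d\<close> is orthogonal to
  itself.\<close>

lemma adj_graph_iff:
  "adj_graph Q C g h \<longleftrightarrow> (\<exists>g1. ae_eq g1 g \<and> LDir (\<lambda>x. cnj (Q x)) (cnj C) g1 h)"
proof -
  interpret star: L2_potential "\<lambda>x. cnj (Q x)" "cnj C" by (rule conjugate_potential)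
  show ?thesis
  proof
    assume "\<exists>g1. ae_eq g1 g \<and> LDir (\<lambda>x. cnj (Q x)) (cnj C) g1 h"
    then obtain g1 where g1: "ae_eq g1 g" "LDir (\<lambda>x. cnj (Q x)) (cnj C) g1 h" by blast
    have L2g1: "L2 g1" using L2_continuous[OF star.LDir_continuous[OF g1(2)]] .
    have ae: "ae_eq g g1" using g1(1) unfolding ae_eq_def by (rule eventually_mono) simp
    show "adj_graph Q C g h" unfolding adj_graph_def
    proof (intro conjI allI impI)
      show "L2 g" using L2_cong_AE[OF L2g1 ae] .
      show "L2 h" using star.LDir_L2[OF g1(2)] .
      fix y f assume y: "LDir Q C y f"
      show "H0_inner f g = H0_inner y h"
        using H0_inner_cong_AE[OF LDir_L2[OF y] L2g1 ae] Lagrange_identity[OF y g1(2)] by simp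
    qed
  next
    assume adj: "adj_graph Q C g h"
    then have g: "L2 g" and h: "L2 h" unfolding adj_graph_def by auto
    obtain lam where lam: "y2 lam pi \<noteq> 0" using y2_pi_nonzero_exists by blast
    \<comment> \<open>Conjugating \<open>y2\<close> shows that \<open>cnj lam\<close> is a regular
      point of the conjugate problem.\<close>
    have "star.sys (cnj lam) (\<lambda>_. 0) (\<lambda>_. 1) (\<lambda>x. cnj (y2 lam x)) (\<lambda>x. cnj (u2 lam x))"
      using qd_system_cnj[OF sys_sol2[of lam]] by simp
    from star.sys_unique(1)[OF this star.sys_sol2, of pi] have lam': "star.y2 (cnj lam) pi \<noteq> 0"
      using lam by auto
    obtain g1 where g1: "LDir (\<lambda>x. cnj (Q x)) (cnj C) g1 (\<lambda>x. (h x + (- cnj lam) * g x) + cnj lam * g1 x)"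
      using star.LDir_solvable[OF lam' L2_add[OF h L2_cmult[OF g]]] .
    have L2g1: "L2 g1" using L2_continuous[OF star.LDir_continuous[OF g1]] .
    define d where "d = (\<lambda>x. g1 x + (-1) * g x)"
    have d: "L2 d" unfolding d_def by (intro L2_add L2_cmult g L2g1)
    obtain y where y: "LDir Q C y (\<lambda>x. d x + lam * y x)" using LDir_solvable[OF lam d] .
    have L2y: "L2 y" using L2_continuous[OF LDir_continuous[OF y]] .
    note L2f = LDir_L2[OF y]
    have A: "H0_inner (\<lambda>x. d x + lam * y x) g = H0_inner y h" using adj y unfolding adj_graph_def by blast
    have "(\<lambda>x. (h x + (- cnj lam) * g x) + cnj lam * g1 x) = (\<lambda>x. h x + cnj lam * d x)"
      unfolding d_def by (auto simp: algebra_simps)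
    then have B: "H0_inner (\<lambda>x. d x + lam * y x) g1 = H0_inner y (\<lambda>x. h x + cnj lam * d x)"
      using Lagrange_identity[OF y g1] by simp
    have "H0_inner (\<lambda>x. d x + lam * y x) d = H0_inner (\<lambda>x. d x + lam * y x) g1 - H0_inner (\<lambda>x. d x + lam * y x) g"
      using H0_inner_linear_right[OF L2g1 g L2f, of "-1"] unfolding d_def[symmetric] by simp
    also have "\<dots> = lam * H0_inner y d" unfolding A B using H0_inner_linear_right[OF h d L2y, of "cnj lam"] by simp
    finally have "H0_inner d d = 0" using H0_inner_linear_left[OF d L2y d, of lam] by simp
    then have "ae_eq d (\<lambda>_. 0)" using H0_inner_self[OF d] H0_norm_eq_0_iff[OF d] by simp
    then have ae: "AE x in I_pi. g1 x = g x" unfolding ae_eq_def d_def by (rule eventually_mono) simp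
    have "LDir (\<lambda>x. cnj (Q x)) (cnj C) g1 h"
      using g1 by (rule LDir_cong_AE) (use ae in \<open>auto simp: ae_eq_def elim: eventually_mono\<close>)
    then show "\<exists>g1. ae_eq g1 g \<and> LDir (\<lambda>x. cnj (Q x)) (cnj C) g1 h"
      using ae unfolding ae_eq_def by blast
  qed
qed

end

section \<open>Density of the domain\<close>

lemma H0_norm_tendsto_0_dominated:
  assumes g: "\<And>n. g n \<in> borel_measurable I_pi" and G: "L2 G"
    and dom: "\<And>n x. x \<in> {0..pi} \<Longrightarrow> cmod (g n x) \<le> cmod (G x)"
    and lim: "AE x in I_pi. (\<lambda>n. g n x) \<longlonglongrightarrow> 0"
  shows "(\<lambda>n. H0_norm (g n)) \<longlonglongrightarrow> 0"
proof -
  have "(\<lambda>n. LINT x|I_pi. (cmod (g n x))\<^sup>2) \<longlonglongrightarrow> (LINT x|I_pi. 0)"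
  proof (rule integral_dominated_convergence)
    show "integrable I_pi (\<lambda>x. (cmod (G x))\<^sup>2)" using G unfolding L2_def by blast
    show "(\<lambda>x. (cmod (g n x))\<^sup>2) \<in> borel_measurable I_pi" for n using g[of n] by measurable
    show "AE x in I_pi. (\<lambda>n. (cmod (g n x))\<^sup>2) \<longlonglongrightarrow> 0"
      using lim by (rule eventually_mono) (use tendsto_power[OF tendsto_norm, of _ 0 _ 2] in fastforce)
    show "AE x in I_pi. norm ((cmod (g n x))\<^sup>2) \<le> (cmod (G x))\<^sup>2" for n
      using dom by (intro AE_I2) (auto intro!: power_mono)
  qed simp
  then have "(\<lambda>n. sqrt ((LINT x|I_pi. (cmod (g n x))\<^sup>2) / pi)) \<longlonglongrightarrow> sqrt ((LINT x|I_pi. 0) / pi)"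
    by (intro tendsto_real_sqrt tendsto_divide tendsto_const) auto
  then show ?thesis unfolding H0_norm_def by simp
qed

lemma H0_norm_tendsto_0_obtains:
  assumes "(\<lambda>n. H0_norm (g n)) \<longlonglongrightarrow> 0" "\<epsilon> > 0"
  obtains n :: nat where "H0_norm (g n) < \<epsilon>"
proof -
  have "\<forall>\<^sub>F n in sequentially. H0_norm (g n) < \<epsilon>" using assms by (rule order_tendstoD)
  then show ?thesis using that by (auto simp: eventually_sequentially)
qed

lemma H0_norm_add_less:
  assumes "L2 f" "L2 g" "H0_norm f < \<epsilon> / 2" "H0_norm g < \<epsilon> / 2"
  shows "H0_norm (\<lambda>x. f x + g x) < \<epsilon>"
proof -
  have "\<epsilon> > 0" using H0_norm_nonneg[of f] assms(3) by linarith
  have "(H0_norm f)\<^sup>2 < (\<epsilon> / 2)\<^sup>2" "(H0_norm g)\<^sup>2 < (\<epsilon> / 2)\<^sup>2"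
    using assms H0_norm_nonneg by (auto intro!: power_strict_mono)
  then have "(H0_norm (\<lambda>x. f x + g x))\<^sup>2 < \<epsilon>\<^sup>2"
    using H0_norm_add_sq_le[OF assms(1,2)] by (simp add: power_divide)
  then show ?thesis using \<open>\<epsilon> > 0\<close> by (simp add: power_less_imp_less_base)
qed

text \<open>Truncation by projecting onto a disc: unlike a cut-off by indicator functions it is
  continuous, so it keeps continuous approximants continuous.\<close>

definition clip :: "real \<Rightarrow> complex \<Rightarrow> complex" where
  "clip k = closest_point (cball 0 k)"

lemma clip:
  assumes "k \<ge> 0"
  shows "continuous_on UNIV (clip k)" "cmod (clip k z) \<le> k" "cmod z \<le> k \<Longrightarrow> clip k z = z" "cmod (clip k z) \<le> cmod z"
proof -
  have b: "convex (cball (0::complex) k)" "closed (cball (0::complex) k)" "cball (0::complex) k \<noteq> {}" using assms by auto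
  show "continuous_on UNIV (clip k)" unfolding clip_def by (rule continuous_on_closest_point[OF b])
  show "cmod (clip k z) \<le> k" using closest_point_in_set[OF b(2,3), of z] unfolding clip_def by simp
  show id: "cmod z \<le> k \<Longrightarrow> clip k z = z" for z unfolding clip_def by (rule closest_point_self) simp
  show "cmod (clip k z) \<le> cmod z"
    using closest_point_lipschitz[OF b, of z 0] id[of 0] assms unfolding clip_def by simp
qed

lemma L2_approx_clip:
  assumes f: "L2 f" and \<epsilon>: "\<epsilon> > 0"
  obtains n :: nat where "H0_norm (\<lambda>x. f x - clip (real n) (f x)) < \<epsilon>" "L2 (\<lambda>x. clip (real n) (f x))"
proof -
  have fm: "f \<in> borel_measurable I_pi" using f unfolding L2_def by blast
  have cm: "(\<lambda>x. clip (real n) (f x)) \<in> borel_measurable I_pi" for n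
    using measurable_compose[OF fm borel_measurable_continuous_onI[OF clip(1)[of "real n"]]] by simp
  have "(\<lambda>n. H0_norm (\<lambda>x. f x - clip (real n) (f x))) \<longlonglongrightarrow> 0"
  proof (rule H0_norm_tendsto_0_dominated)
    show "(\<lambda>x. f x - clip (real n) (f x)) \<in> borel_measurable I_pi" for n using fm cm by (rule borel_measurable_diff)
    show "L2 (\<lambda>x. 2 * f x)" using f by (rule L2_cmult)
    show "cmod (f x - clip (real n) (f x)) \<le> cmod (2 * f x)" for n x
      using norm_triangle_ineq4[of "f x" "clip (real n) (f x)"] clip(4)[of "real n" "f x"] by (simp add: norm_mult)
    have "(\<lambda>n. f x - clip (real n) (f x)) \<longlonglongrightarrow> 0" for x
    proof (rule tendsto_eventually)
      show "\<forall>\<^sub>F n in sequentially. f x - clip (real n) (f x) = 0"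
        using eventually_ge_at_top[of "nat \<lceil>cmod (f x)\<rceil>"] by (rule eventually_mono) (auto simp: clip(3) nat_ceiling_le_eq)
    qed
    then show "AE x in I_pi. (\<lambda>n. f x - clip (real n) (f x)) \<longlonglongrightarrow> 0" by simp
  qed
  then obtain n where n: "H0_norm (\<lambda>x. f x - clip (real n) (f x)) < \<epsilon>" using \<epsilon> by (rule H0_norm_tendsto_0_obtains)
  have "L2 (\<lambda>x. clip (real n) (f x) * 1)"
    by (rule L2_mult_bounded[OF L2_continuous cm, of _ _ "real n"]) (auto simp: clip(2))
  with n show ?thesis using that by simp
qed

text \<open>Measurability gives continuous approximants converging almost everywhere, but with no
  dominating function. Truncating both \<open>f\<close> and the approximants at the same level
  \<open>k\<close> supplies the constant bound \<open>2 * k\<close>.\<close>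

lemma L2_approx_continuous:
  assumes f: "L2 f" and \<epsilon>: "\<epsilon> > 0"
  obtains \<phi> where "continuous_on UNIV \<phi>" "H0_norm (\<lambda>x. f x - \<phi> x) < \<epsilon>"
proof -
  obtain k :: nat where k: "H0_norm (\<lambda>x. f x - clip (real k) (f x)) < \<epsilon> / 2" and L2k: "L2 (\<lambda>x. clip (real k) (f x))"
    using L2_approx_clip[OF f, of "\<epsilon> / 2"] \<epsilon> by auto
  have "f measurable_on {0..pi}"
    using f unfolding L2_def by (subst measurable_on_iff_borel_measurable) auto
  then obtain N g where N: "negligible N" and g: "\<And>n. continuous_on UNIV (g n)"
    and lim: "\<And>x. x \<notin> N \<Longrightarrow> (\<lambda>n. g n x) \<longlonglongrightarrow> (if x \<in> {0..pi} then f x else 0)"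
    unfolding measurable_on_def by blast
  have cg: "continuous_on UNIV (\<lambda>x. clip (real k) (g n x))" for n
    by (rule continuous_on_compose2[OF clip(1) g]) auto
  have L2g: "L2 (\<lambda>x. clip (real k) (g n x))" for n
    using continuous_on_subset[OF cg] by (intro L2_continuous) auto
  have "(\<lambda>n. H0_norm (\<lambda>x. clip (real k) (f x) - clip (real k) (g n x))) \<longlonglongrightarrow> 0"
  proof (rule H0_norm_tendsto_0_dominated)
    show "(\<lambda>x. clip (real k) (f x) - clip (real k) (g n x)) \<in> borel_measurable I_pi" for n
      using L2k L2g[of n] unfolding L2_def by (intro borel_measurable_diff) auto
    show "L2 (\<lambda>x. complex_of_real (2 * real k))" by (intro L2_continuous continuous_on_const)
    show "cmod (clip (real k) (f x) - clip (real k) (g n x)) \<le> cmod (complex_of_real (2 * real k))" for n x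
      using norm_triangle_ineq4[of "clip (real k) (f x)" "clip (real k) (g n x)"] clip(2)[of "real k" "f x"] clip(2)[of "real k" "g n x"]
      unfolding norm_of_real by simp
    have conv: "(\<lambda>n. clip (real k) (f x) - clip (real k) (g n x)) \<longlonglongrightarrow> 0" if "x \<notin> N" "x \<in> {0..pi}" for x
    proof -
      have "(\<lambda>n. g n x) \<longlonglongrightarrow> f x" using lim[OF that(1)] that(2) by simp
      then have "(\<lambda>n. clip (real k) (g n x)) \<longlonglongrightarrow> clip (real k) (f x)"
        using clip(1)[of "real k"] by (auto intro: isCont_tendsto_compose simp: continuous_on_eq_continuous_at)
      from tendsto_diff[OF tendsto_const this, of "clip (real k) (f x)"] show ?thesis by simp
    qed
    have "AE x in lebesgue. x \<notin> N" using N by (simp add: negligible_iff_null_sets AE_not_in)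
    then have "AE x in lebesgue. x \<in> {0..pi} \<longrightarrow> (\<lambda>n. clip (real k) (f x) - clip (real k) (g n x)) \<longlonglongrightarrow> 0"
      by (rule eventually_mono) (use conv in blast)
    then show "AE x in I_pi. (\<lambda>n. clip (real k) (f x) - clip (real k) (g n x)) \<longlonglongrightarrow> 0"
      by (subst AE_restrict_space_iff) auto
  qed
  then obtain n where n: "H0_norm (\<lambda>x. clip (real k) (f x) - clip (real k) (g n x)) < \<epsilon> / 2"
    using half_gt_zero[OF \<epsilon>] by (rule H0_norm_tendsto_0_obtains)
  from H0_norm_add_less[OF L2_diff[OF f L2k] L2_diff[OF L2k L2g] k n]
  have "H0_norm (\<lambda>x. f x - clip (real k) (g n x)) < \<epsilon>" by simp
  then show ?thesis using that cg by blast
qed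

lemma L2_approx_polynomial:
  assumes f: "L2 f" and \<epsilon>: "\<epsilon> > 0"
  obtains p where "polynomial_function p" "H0_norm (\<lambda>x. f x - p x) < \<epsilon>"
proof -
  obtain \<phi> where \<phi>: "continuous_on UNIV \<phi>" "H0_norm (\<lambda>x. f x - \<phi> x) < \<epsilon> / 2"
    using L2_approx_continuous[OF f, of "\<epsilon> / 2"] \<epsilon> by auto
  have c\<phi>: "continuous_on {0..pi} \<phi>" using \<phi>(1) continuous_on_subset by blast
  \<comment> \<open>\<open>\<epsilon> / 3\<close> because a pointwise bound yields only a weak
    inequality for the norm, while both summands must stay strictly below
    \<open>\<epsilon> / 2\<close>.\<close>
  obtain p where p: "polynomial_function p" "\<And>x. x \<in> {0..pi} \<Longrightarrow> cmod (\<phi> x - p x) < \<epsilon> / 3"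
    using Stone_Weierstrass_polynomial_function[OF compact_Icc c\<phi>, of "\<epsilon> / 3"] \<epsilon> by auto
  have cp: "continuous_on {0..pi} p" using p(1) by (rule continuous_on_polymonial_function)
  have d: "L2 (\<lambda>x. \<phi> x - p x)" using c\<phi> cp by (intro L2_continuous continuous_on_diff)
  have "H0_norm (\<lambda>x. \<phi> x - p x) \<le> \<epsilon> / 3"
    by (rule H0_norm_le_sup[OF less_imp_le[OF p(2)] d]) (use \<epsilon> in auto)
  then have "H0_norm (\<lambda>x. \<phi> x - p x) < \<epsilon> / 2" using \<epsilon> by linarith
  from H0_norm_add_less[OF L2_diff[OF f L2_continuous[OF c\<phi>]] d \<phi>(2) this]
  show ?thesis using that[OF p(1)] by simp
qed

text \<open>The factor \<open>1 - (1 - 2x/\<pi>)^(2n)\<close> vanishes at both endpoints and tends to 1 in between.\<close>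
lemma L2_approx_polynomial_zero_boundary:
  assumes f: "L2 f" and \<epsilon>: "\<epsilon> > 0"
  obtains p where "polynomial_function p" "p 0 = 0" "p pi = 0" "H0_norm (\<lambda>x. f x - p x) < \<epsilon>"
proof -
  obtain p where p: "polynomial_function p" "H0_norm (\<lambda>x. f x - p x) < \<epsilon> / 2"
    using L2_approx_polynomial[OF f, of "\<epsilon> / 2"] \<epsilon> by auto
  have cp: "continuous_on {0..pi} p" using p(1) by (rule continuous_on_polymonial_function)
  define r where "r = (\<lambda>x::real. (1 - 2 * x / pi)\<^sup>2)"
  have r: "0 \<le> r x" "r x \<le> 1" if "x \<in> {0..pi}" for x
  proof -
    have "\<bar>1 - 2 * x / pi\<bar> \<le> 1" using that by (auto simp: abs_le_iff field_simps)
    then show "0 \<le> r x" "r x \<le> 1" unfolding r_def by (simp_all only: abs_square_le_1 zero_le_power2)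
  qed
  have r1: "r x < 1" if "x \<in> {0..pi}" "x \<noteq> 0" "x \<noteq> pi" for x
  proof -
    have "\<bar>1 - 2 * x / pi\<bar> < 1" using that by (auto simp: abs_less_iff field_simps)
    then show "r x < 1" unfolding r_def by (simp only: abs_square_less_1)
  qed
  define g where "g = (\<lambda>n x. (1 - r x ^ Suc n) *\<^sub>R p x)"
  have "real_polynomial_function (\<lambda>x::real. x)" by (rule real_polynomial_function.intros(1)[OF bounded_linear_ident])
  then have "real_polynomial_function (\<lambda>x. 1 - r x ^ Suc n)" for n
    unfolding r_def
    by (intro real_polynomial_function_diff real_polynomial_function_power real_polynomial_function_divide
        real_polynomial_function.intros(2,4))
  then have pr: "polynomial_function (\<lambda>x. 1 - r x ^ Suc n)" for n
    unfolding real_polynomial_function_eq .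
  have pg: "polynomial_function (g n)" for n
    unfolding g_def using pr p(1) by (rule polynomial_function_mult)
  have L2d: "L2 (\<lambda>x. p x - g n x)" for n
    using cp continuous_on_polymonial_function[OF pg] by (intro L2_continuous continuous_on_diff)
  have d: "p x - g n x = r x ^ Suc n *\<^sub>R p x" for n x unfolding g_def by (simp add: algebra_simps)
  have "(\<lambda>n. H0_norm (\<lambda>x. p x - g n x)) \<longlonglongrightarrow> 0"
  proof (rule H0_norm_tendsto_0_dominated)
    show "(\<lambda>x. p x - g n x) \<in> borel_measurable I_pi" for n using L2d unfolding L2_def by blast
    show "L2 p" using cp by (rule L2_continuous)
    show "cmod (p x - g n x) \<le> cmod (p x)" if "x \<in> {0..pi}" for n x
      unfolding d norm_scaleR using r[OF that] power_le_one[of "r x" "Suc n"]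
      by (simp add: mult_left_le_one_le del: power_Suc)
    have conv: "(\<lambda>n. p x - g n x) \<longlonglongrightarrow> 0" if "x \<notin> {0, pi}" "x \<in> {0..pi}" for x
    proof -
      have "(\<lambda>n. r x ^ Suc n *\<^sub>R p x) \<longlonglongrightarrow> 0 *\<^sub>R p x"
        using r[OF that(2)] r1 that by (intro tendsto_scaleR tendsto_const LIMSEQ_Suc LIMSEQ_realpow_zero) auto
      then show ?thesis unfolding d by simp
    qed
    have "negligible {0, pi}" by simp
    then have "AE x in lebesgue. x \<notin> {0, pi}" unfolding negligible_iff_null_sets by (rule AE_not_in)
    then have "AE x in lebesgue. x \<in> {0..pi} \<longrightarrow> (\<lambda>n. p x - g n x) \<longlonglongrightarrow> 0"
      by (rule eventually_mono) (use conv in blast)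
    then show "AE x in I_pi. (\<lambda>n. p x - g n x) \<longlonglongrightarrow> 0"
      by (subst AE_restrict_space_iff) auto
  qed
  then obtain n where n: "H0_norm (\<lambda>x. p x - g n x) < \<epsilon> / 2"
    using half_gt_zero[OF \<epsilon>] by (rule H0_norm_tendsto_0_obtains)
  from H0_norm_add_less[OF L2_diff[OF f L2_continuous[OF cp]] L2d p(2) n]
  have "H0_norm (\<lambda>x. f x - g n x) < \<epsilon>" by simp
  moreover have "g n 0 = 0" "g n pi = 0" unfolding g_def r_def by auto
  ultimately show ?thesis using that[OF pg] by blast
qed

lemma norm_integral_mult_le:
  assumes "L2 f" "L2 g" "x \<in> {0..pi}"
  shows "cmod (integral {0..x} (\<lambda>t. f t * g t)) \<le> pi * H0_norm f * H0_norm g"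
proof -
  have s: "sqrt (LINT x|I_pi. (cmod (h x))\<^sup>2) = sqrt pi * H0_norm h" for h :: "real \<Rightarrow> complex"
    unfolding H0_norm_def by (simp add: real_sqrt_mult[symmetric])
  have "cmod (integral {0..x} (\<lambda>t. f t * g t)) \<le> (LINT x|I_pi. cmod (f x * g x))"
    by (rule norm_integral_le_L1[OF L2_mult_integrable[OF assms(1,2)] assms(3)])
  also have "\<dots> \<le> (sqrt pi * H0_norm f) * (sqrt pi * H0_norm g)"
    using L2_Cauchy_Schwarz[OF assms(1,2)] unfolding s .
  also have "\<dots> = (sqrt pi * sqrt pi) * (H0_norm f * H0_norm g)" by (simp only: mult_ac)
  finally show ?thesis by (simp add: mult.assoc)
qed

context L2_potential
begin

text \<open>Given smooth \<open>g\<close> and a smooth potential \<open>p\<close> close to \<open>Q\<close> in \<open>H\<^sup>0\<close>, solve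
  \<open>(L(Q) - \<lambda>) y = (L(p) - \<lambda>) g\<close>: the difference of \<open>(y, y' - Qy)\<close> and \<open>(g, g' - pg)\<close> solves the system
  with a forcing that is linear in \<open>Q - p\<close>, so \<open>y\<close> is uniformly close to \<open>g\<close>.\<close>
lemma approx_by_domain:
  assumes lam: "y2 lam pi \<noteq> 0"
    and p: "polynomial_function p" and g: "polynomial_function g" and g0: "g 0 = 0" "g pi = 0"
    and g': "polynomial_function g'" "\<And>x. (g has_vector_derivative g' x) (at x)"
  obtains y f where "LDir Q C y f" "\<And>x. x \<in> {0..pi} \<Longrightarrow>
    cmod (y x - g x) \<le> bvp_const lam * (pi * H0_norm (\<lambda>x. Q x - p x) * (H0_norm g + H0_norm (\<lambda>x. Q x * g x + g' x)))"
proof -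
  obtain p' where p': "polynomial_function p'" "\<And>x. (p has_vector_derivative p' x) (at x)"
    using has_vector_derivative_polynomial_function[OF p] by blast
  obtain g'' where g'': "polynomial_function g''" "\<And>x. (g' has_vector_derivative g'' x) (at x)"
    using has_vector_derivative_polynomial_function[OF g'(1)] by blast
  note cont = p[THEN continuous_on_polymonial_function] g[THEN continuous_on_polymonial_function]
    g'(1)[THEN continuous_on_polymonial_function] p'(1)[THEN continuous_on_polymonial_function]
    g''(1)[THEN continuous_on_polymonial_function]
  \<comment> \<open>This is \<open>(L(p) - lam) g\<close>, that is
    \<open>- v' - p g' + (C - lam) g\<close>, in which the \<open>p g'\<close> terms cancel.\<close>
  define f where "f = (\<lambda>x. - g'' x + p' x * g x + (C - lam) * g x)"
  define v where "v = (\<lambda>x. g' x - p x * g x)"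
  define v' where "v' = (\<lambda>x. g'' x - (p x * g' x + p' x * g x))"
  have cf: "continuous_on {0..pi} f" and cv: "continuous_on {0..pi} v" and cv': "continuous_on {0..pi} v'"
    unfolding f_def v_def v'_def by (intro continuous_intros cont)+
  have gint: "g x = integral {0..x} g'" if "x \<in> {0..pi}" for x
  proof -
    have "(g' has_integral g x - g 0) {0..x}"
      using that g'(2) by (intro fundamental_theorem_of_calculus) (auto intro: has_vector_derivative_at_within)
    then show ?thesis using g0 by (simp add: integral_unique)
  qed
  have vint: "v x = v 0 + integral {0..x} v'" if "x \<in> {0..pi}" for x
  proof -
    have "(v has_vector_derivative v' x) (at x)" for x
      unfolding v_def v'_def using g'(2) g''(2) p'(2)
      by (intro has_vector_derivative_diff has_vector_derivative_mult)
    then have "(v' has_integral v x - v 0) {0..x}"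
      using that by (intro fundamental_theorem_of_calculus) (auto intro: has_vector_derivative_at_within)
    then show ?thesis by (simp add: integral_unique)
  qed
  define d where "d = (\<lambda>x. Q x - p x)"
  have L2d: "L2 d" unfolding d_def by (rule L2_diff[OF L2_Q L2_continuous[OF cont(1)]])
  have L2h: "L2 (\<lambda>x. Q x * g x + g' x)"
    using L2_add[OF L2_continuous_mult[OF L2_Q cont(2)] L2_continuous[OF cont(3)]] by (simp add: mult.commute)
  obtain c y u where s: "sys lam (\<lambda>_. 0) (\<lambda>x. c + - integral {0..x} f) y u" and ypi: "y pi = 0"
    by (rule bvp_exists[OF lam continuous_on_const[of _ 0]
          continuous_on_minus[OF continuous_on_integral_I_pi[OF integrable_continuous_I_pi[OF cf]]]])
  let ?R1 = "\<lambda>t. Q t * g t + v t" and ?R2 = "\<lambda>t. (C - lam - (Q t)\<^sup>2) * g t - Q t * v t"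
  have R: "integrable I_pi ?R1" "integrable I_pi ?R2" by (rule integrable_rhs[OF cont(2) cv])+
  \<comment> \<open>Any continuous pair solves the system once its defect is declared to be the
    forcing; the next step expresses the defect through \<open>d\<close>.\<close>
  have sg: "sys lam (\<lambda>x. g x - integral {0..x} ?R1) (\<lambda>x. v x - integral {0..x} ?R2) g v"
    unfolding qd_system_def using cont(2) cv by simp
  have D: "sys lam (\<lambda>x. integral {0..x} (\<lambda>t. d t * g t)) (\<lambda>x. (c - v 0) + - integral {0..x} (\<lambda>t. d t * (Q t * g t + g' t)))
     (\<lambda>x. y x + (-1) * g x) (\<lambda>x. u x + (-1) * v x)"
  proof (rule sys_cong[OF sys_add_scaled[OF s sg, of "-1"]])
    fix x assume x: "x \<in> {0..pi}"
    note hk = integrable_I_pi_subinterval(2)[where a=0 and b=x]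
    have "integral {0..x} ?R1 - integral {0..x} g' = integral {0..x} (\<lambda>t. ?R1 t - g' t)"
      using x by (intro Henstock_Kurzweil_Integration.integral_diff[symmetric] hk R integrable_continuous_I_pi cont) auto
    also have "\<dots> = integral {0..x} (\<lambda>t. d t * g t)"
      unfolding d_def v_def by (intro arg_cong[where f="integral _"] ext) (simp add: algebra_simps)
    finally show "0 + (-1) * (g x - integral {0..x} ?R1) = integral {0..x} (\<lambda>t. d t * g t)"
      using gint[OF x] by simp
    have "integral {0..x} ?R2 - integral {0..x} (\<lambda>t. f t + v' t) = integral {0..x} (\<lambda>t. ?R2 t - (f t + v' t))"
      using x cf cv' by (intro Henstock_Kurzweil_Integration.integral_diff[symmetric] hk R integrable_continuous_I_pi continuous_on_add) auto
    \<comment> \<open>The terms with \<open>g''\<close>, \<open>p'\<close> and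
      \<open>C - lam\<close> drop out. This matters because \<open>p'\<close> is not controlled as
      \<open>p\<close> approaches \<open>Q\<close>; one factor \<open>d\<close> remains against the
      square integrable \<open>Q g + g'\<close>, ready for Cauchy-Schwarz.\<close>
    also have "(\<lambda>t. ?R2 t - (f t + v' t)) = (\<lambda>t. - (d t * (Q t * g t + g' t)))"
      unfolding d_def v_def v'_def f_def by (intro ext) (simp add: algebra_simps power2_eq_square)
    also have "integral {0..x} (\<lambda>t. f t + v' t) = integral {0..x} f + integral {0..x} v'"
      using x cf cv' by (intro Henstock_Kurzweil_Integration.integral_add hk integrable_continuous_I_pi) auto
    also have "integral {0..x} (\<lambda>t. - (d t * (Q t * g t + g' t))) = - integral {0..x} (\<lambda>t. d t * (Q t * g t + g' t))"
      by (rule integral_neg)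
    finally have eq: "integral {0..x} ?R2 - (integral {0..x} f + integral {0..x} v') = - integral {0..x} (\<lambda>t. d t * (Q t * g t + g' t))" .
    have "c + - F + (-1) * (vx - A) = c - v0 + - D" if "A - (F + V) = - D" "vx = v0 + V" for A F V D vx v0 :: complex
      using that by algebra
    from this[OF eq vint[OF x]]
    show "c + - integral {0..x} f + (-1) * (v x - integral {0..x} ?R2) = c - v 0 + - integral {0..x} (\<lambda>t. d t * (Q t * g t + g' t))" .
  qed
  have bound: "cmod (y x - g x) \<le> bvp_const lam * (pi * H0_norm d * (H0_norm g + H0_norm (\<lambda>x. Q x * g x + g' x)))"
    if x: "x \<in> {0..pi}" for x
  proof -
    have nn: "0 \<le> pi * H0_norm d * H0_norm g" "0 \<le> pi * H0_norm d * H0_norm (\<lambda>x. Q x * g x + g' x)"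
      by (auto intro!: mult_nonneg_nonneg H0_norm_nonneg)
    have "cmod (y x + (-1) * g x) \<le> bvp_const lam * (pi * H0_norm d * (H0_norm g + H0_norm (\<lambda>x. Q x * g x + g' x)))"
    proof (rule bvp_bound[OF lam D _ _ _ x])
      show "y pi + (-1) * g pi = 0" using ypi g0 by simp
      fix t assume t: "t \<in> {0..pi}"
      show "cmod (integral {0..t} (\<lambda>t. d t * g t)) \<le> pi * H0_norm d * (H0_norm g + H0_norm (\<lambda>x. Q x * g x + g' x))"
        using norm_integral_mult_le[OF L2d L2_continuous[OF cont(2)] t] nn(2) by (simp add: distrib_left)
      show "cmod (- integral {0..t} (\<lambda>t. d t * (Q t * g t + g' t))) \<le> pi * H0_norm d * (H0_norm g + H0_norm (\<lambda>x. Q x * g x + g' x))"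
        using norm_integral_mult_le[OF L2d L2h t] nn(1) unfolding norm_minus_cancel distrib_left by linarith
    qed
    then show ?thesis by simp
  qed
  have s': "sys lam (\<lambda>_. 0) (\<lambda>x. c - integral {0..x} f) y u" using s by simp
  show ?thesis using that sys_imp_LDir[OF s' ypi L2_continuous[OF cf]] bound unfolding d_def by blast
qed

lemma dense_domain_LDir: "dense_domain Q C"
  unfolding dense_domain_def
proof (intro allI impI)
  fix h and e :: real assume h: "L2 h" and e: "e > 0"
  obtain lam where lam: "y2 lam pi \<noteq> 0" using y2_pi_nonzero_exists by blast
  obtain g where g: "polynomial_function g" "g 0 = 0" "g pi = 0" and hg: "H0_norm (\<lambda>x. h x - g x) < e / 2"
    using L2_approx_polynomial_zero_boundary[OF h, of "e / 2"] e by auto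
  obtain g' where g': "polynomial_function g'" "\<And>x. (g has_vector_derivative g' x) (at x)"
    using has_vector_derivative_polynomial_function[OF g(1)] by blast
  \<comment> \<open>\<open>B\<close> depends on \<open>g\<close> but not on \<open>p\<close>:
    \<open>g\<close> is fixed first, and then \<open>p\<close> is taken close enough to
    \<open>Q\<close>.\<close>
  define B where "B = H0_norm g + H0_norm (\<lambda>x. Q x * g x + g' x)"
  have B: "B \<ge> 0" unfolding B_def by (intro add_nonneg_nonneg H0_norm_nonneg)
  \<comment> \<open>\<open>B + 1\<close> keeps the denominator positive, and the 3 leaves strict
    room below \<open>e / 2\<close>.\<close>
  define \<eta> where "\<eta> = e / (3 * (bvp_const lam * pi * (B + 1)))"
  have K: "bvp_const lam * pi * (B + 1) > 0" using bvp_const_pos[of lam] B by (intro mult_pos_pos) auto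
  have \<eta>: "\<eta> > 0" unfolding \<eta>_def using e K by simp
  obtain p where p: "polynomial_function p" "H0_norm (\<lambda>x. Q x - p x) < \<eta>"
    using L2_approx_polynomial[OF L2_Q \<eta>] .
  obtain y f where y: "LDir Q C y f" and "\<And>x. x \<in> {0..pi} \<Longrightarrow>
    cmod (y x - g x) \<le> bvp_const lam * (pi * H0_norm (\<lambda>x. Q x - p x) * B)"
    using approx_by_domain[OF lam p(1) g g'] unfolding B_def by blast
  moreover have "bvp_const lam * (pi * H0_norm (\<lambda>x. Q x - p x) * B) \<le> e / 3"
  proof -
    have "bvp_const lam * (pi * H0_norm (\<lambda>x. Q x - p x) * B) \<le> bvp_const lam * (pi * \<eta> * (B + 1))"
      using p(2) B \<eta> bvp_const_pos[of lam]
      by (intro mult_left_mono mult_mono) (auto simp: H0_norm_nonneg)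
    also have "\<dots> = (bvp_const lam * pi * (B + 1)) * \<eta>" by (simp only: mult_ac)
    also have "\<dots> = e / 3" unfolding \<eta>_def using K by (simp add: field_simps)
    finally show ?thesis .
  qed
  ultimately have yg: "cmod (y x - g x) \<le> e / 3" if "x \<in> {0..pi}" for x using that by fastforce
  have cg: "L2 g" using continuous_on_polymonial_function[OF g(1)] by (rule L2_continuous)
  have L2y: "L2 y" using L2_continuous[OF LDir_continuous[OF y]] .
  have "H0_norm (\<lambda>x. y x - g x) \<le> e / 3"
    by (rule H0_norm_le_sup[OF yg L2_diff[OF L2y cg]]) (use e in auto)
  then have "H0_norm (\<lambda>x. y x - g x) < e / 2" using e by linarith
  moreover have "H0_norm (\<lambda>x. g x - h x) < e / 2"
    using hg unfolding H0_norm_def by (simp add: norm_minus_commute)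
  ultimately have "H0_norm (\<lambda>x. y x - h x) < e"
    using H0_norm_add_less[OF L2_diff[OF L2y cg] L2_diff[OF cg h]] by simp
  then show "\<exists>y f. LDir Q C y f \<and> H0_norm (\<lambda>x. y x - h x) < e" using y by blast
qed

end

theorem theorem13:
  fixes Q :: "real \<Rightarrow> complex" and C :: complex
  assumes "Q \<in> borel_measurable lebesgue"
    and "\<forall>T. integrable (lebesgue_on {-T..T}) (\<lambda>x. (cmod (Q x))^2)"
    and "AE x in lebesgue. Q (x + pi) = Q x"
    and "integral\<^sup>L (lebesgue_on {0..pi}) Q = 0"
  shows "dense_domain Q C \<and>
         closed_op Q C \<and>
         (\<forall>g h. adj_graph Q C g h \<longleftrightarrow> (\<exists>g1. ae_eq g1 g \<and> LDir (\<lambda>x. cnj (Q x)) (cnj C) g1 h)) \<and>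
         discrete_spectrum Q C \<and> spectrum_op Q C = {lam. y2_pi Q C lam = 0}"
proof -
  have "Q \<in> borel_measurable I_pi"
    using assms(1) by (simp add: measurable_restrict_space1)
  moreover have "integrable I_pi (\<lambda>x. (cmod (Q x))\<^sup>2)"
    using assms(2)[rule_format, of pi] by (rule integrable_subinterval) auto
  ultimately interpret L2_potential Q C by unfold_locales (simp add: L2_def)
  show ?thesis
    using dense_domain_LDir closed_op_LDir adj_graph_iff discrete_spectrum_LDir spectrum_eq by blast
qed

end
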